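(* In the spiked model with weights $\Omega,\Pi$ described in the context, the optimal choice of $\widehat{\mathbf B}$, i.e. a minimizer over $\widehat{\mathbf B}'\in\mathbb R^{r\times r}$ of the asymptotic loss $\mathcal L(\widehat{\mathbf U}\widehat{\mathbf B}'\widehat{\mathbf V}^T,\mathbf X)$, is given by $$\widehat{\mathbf B}=\mathbf D^+\,\mathbf C\,\mathrm{diag}(\mathbf t)\,\widetilde{\mathbf C}^T\,\widetilde{\mathbf D}^+,$$ and, for $\widehat{\mathbf X}=\widehat{\mathbf U}\widehat{\mathbf B}\widehat{\mathbf V}^T$, the weighted asymptotic mean squared error is almost surely equal to $$\lim_{n\to\infty}\|\Omega(\widehat{\mathbf X}-\mathbf X)\Pi^T\|_{\mathrm F}^2=\big\langle \mathbf E\,\mathrm{diag}(\mathbf t)\,\widetilde{\mathbf E}-\mathbf C^T\mathbf D^+\mathbf C\,\mathrm{diag}(\mathbf t)\,\widetilde{\mathbf C}^T\widetilde{\mathbf D}^+\widetilde{\mathbf C},\ \mathrm{diag}(\mathbf t)\big\rangle_{\mathrm F}.$$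
   Context: Model. For each $n$ let $p=p_n$, with $p\to\infty$ and $p_n/n\to\gamma$ as $n\to\infty$, where $\gamma$ is well-defined and finite. All vectors and matrices below are sequences indexed by $n$ (or $p$); this index is suppressed. We observe $\mathbf Y=\mathbf X+\mathbf G\in\mathbb R^{p\times n}$, where $\mathbf G$ has iid $N(0,1/n)$ entries and $\mathbf X=\sum_{k=1}^r t_k\mathbf u_k\mathbf v_k^T$; $r$ and $t_1>\dots>t_r>0$ are fixed (independent of $n$), $\mathbf u_1,\dots,\mathbf u_r\in\mathbb R^p$ are orthonormal and $\mathbf v_1,\dots,\mathbf v_r\in\mathbb R^n$ are orthonormal (deterministic, or random and independent of $\mathbf G$). The SVD of the data is $\mathbf Y=\sum_{k=1}^{\min(n,p)}\lambda_k\hat{\mathbf u}_k\hat{\mathbf v}_k^T$ with $\lambda_1\ge\lambda_2\ge\dots\ge0$. Put $\widehat{\mathbf U}=[\hat{\mathbf u}_1,\dots,\hat{\mathbf u}_r]$, $\widehat{\mathbf V}=[\hat{\mathbf v}_1,\dots,\hat{\mathbf v}_r]$, $\mathbf t=(t_1,\dots,t_r)^T$. Weights. $\Omega=\Omega_p$ is a (deterministic) matrix with $p$ columns and $\Pi=\Pi_n$ a (deterministic) matrix with $n$ columns, with operator norms bounded by a constant independent of $p,n$. The following limits are assumed to exist (almost surely) and be finite, for $1\le j,k\le r$: $\mu=\lim \frac1p\mathrm{tr}(\Omega^T\Omega)$, $\nu=\lim\frac1n\mathrm{tr}(\Pi^T\Pi)$, $e_{jk}=\lim\langle\Omega\mathbf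 u_j,\Omega\mathbf u_k\rangle$, $\tilde e_{jk}=\lim\langle\Pi\mathbf v_j,\Pi\mathbf v_k\rangle$; moreover $\mu,\nu,e_{kk},\tilde e_{kk}$ are assumed positive. Sign convention: the signs of the empirical singular vector pairs are chosen so that the almost sure limits of $\langle\hat{\mathbf u}_k,\mathbf u_k\rangle$ and $\langle\hat{\mathbf v}_k,\mathbf v_k\rangle$ are nonnegative (it is known that this is possible). Inner product matrices. The following limits exist almost surely (this is established separately in the paper): $c_{jk}^\omega=\lim\langle\Omega\hat{\mathbf u}_j,\Omega\mathbf u_k\rangle$, $\tilde c_{jk}^\omega=\lim\langle\Pi\hat{\mathbf v}_j,\Pi\mathbf v_k\rangle$, $d_{jk}=\lim\langle\Omega\hat{\mathbf u}_j,\Omega\hat{\mathbf u}_k\rangle$, $\tilde d_{jk}=\lim\langle\Pi\hat{\mathbf v}_j,\Pi\hat{\mathbf v}_k\rangle$. Define the $r\times r$ matrices $\mathbf D=(d_{jk})$, $\widetilde{\mathbf D}=(\tilde d_{jk})$, $\mathbf E=(e_{jk})$, $\widetilde{\mathbf E}=(\tilde e_{jk})$, $\mathbf C=(c^\omega_{jk})$, $\widetilde{\mathbf C}=(\tilde c^\omega_{jk})$. Loss. For a deterministic $\widehat{\mathbf B}'\in\mathbb R^{r\times r}$, the asymptotic loss is the almost sure limit $\mathcal L(\widehat{\mathbf U}\widehat{\mathbf B}'\widehat{\mathbf V}^T,\mathbf X)=\lim_{n\to\infty}\|\Omega(\widehat{\mathbf U}\widehat{\mathbf B}'\widehat{\mathbf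 V}^T-\mathbf X)\Pi^T\|_{\mathrm F}^2$, where $\|\cdot\|_{\mathrm F}$ is the Frobenius norm; $\langle A,B\rangle_{\mathrm F}=\mathrm{tr}(A^TB)$, and $M^+$ is the Moore–Penrose pseudoinverse. *)

theory Defs
  imports "HOL-Probability.Probability" "Jordan_Normal_Form.Matrix"
begin

text \<open>
  The dimensions \<open>p\<close> and \<open>n\<close> vary along the sequence, so vectors and matrices are those of
  \<open>Jordan_Normal_Form.Matrix\<close>, with explicit dimensions. All indices start at \<open>0\<close>.
\<close>

unbundle no vec_syntax
unbundle no inner_syntax
hide_const (open) Finite_Cartesian_Product.mat Finite_Cartesian_Product.vec

definition mat_trace :: "real mat \<Rightarrow> real" where
  "mat_trace A = (\<Sum>i<dim_row A. A $$ (i, i))"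

definition frob_inner :: "real mat \<Rightarrow> real mat \<Rightarrow> real" where
  "frob_inner A B = mat_trace (A\<^sup>T * B)"

definition frob_norm :: "real mat \<Rightarrow> real" where
  "frob_norm A = sqrt (frob_inner A A)"

definition mat_op_norm :: "real mat \<Rightarrow> real" where
  "mat_op_norm A =
     (SUP x\<in>{x \<in> carrier_vec (dim_col A). x \<bullet> x \<le> 1}. sqrt ((A *\<^sub>v x) \<bullet> (A *\<^sub>v x)))"

definition is_pseudoinverse :: "real mat \<Rightarrow> real mat \<Rightarrow> bool" where
  "is_pseudoinverse A X \<longleftrightarrow>
     X \<in> carrier_mat (dim_col A) (dim_row A) \<and>
     A * X * A = A \<and> X * A * X = X \<and> (A * X)\<^sup>T = A * X \<and> (X * A)\<^sup>T = X * A"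

definition pinv :: "real mat \<Rightarrow> real mat" where
  "pinv A = (THE X. is_pseudoinverse A X)"

definition orthonormal_family :: "nat \<Rightarrow> nat \<Rightarrow> (nat \<Rightarrow> real vec) \<Rightarrow> bool" where
  "orthonormal_family d m x \<longleftrightarrow>
     (\<forall>k<m. x k \<in> carrier_vec d) \<and>
     (\<forall>j<m. \<forall>k<m. x j \<bullet> x k = (if j = k then 1 else 0))"

text \<open>The \<open>p \<times> n\<close> matrix \<open>\<Sum>k<m. s\<^sub>k x\<^sub>k y\<^sub>k\<^sup>T\<close>.\<close>

definition sum_outer ::
  "nat \<Rightarrow> nat \<Rightarrow> nat \<Rightarrow> (nat \<Rightarrow> real) \<Rightarrow> (nat \<Rightarrow> real vec) \<Rightarrow> (nat \<Rightarrow> real vec) \<Rightarrow> real mat" where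
  "sum_outer p n m s x y = Matrix.mat p n (\<lambda>(i, j). \<Sum>k<m. s k * (x k $ i) * (y k $ j))"

definition is_svd ::
  "real mat \<Rightarrow> (nat \<Rightarrow> real) \<Rightarrow> (nat \<Rightarrow> real vec) \<Rightarrow> (nat \<Rightarrow> real vec) \<Rightarrow> bool" where
  "is_svd Y s x y \<longleftrightarrow> (let m = min (dim_row Y) (dim_col Y) in
     (\<forall>k<m. 0 \<le> s k) \<and> (\<forall>j<m. \<forall>k<m. j \<le> k \<longrightarrow> s k \<le> s j) \<and>
     orthonormal_family (dim_row Y) m x \<and> orthonormal_family (dim_col Y) m y \<and>
     Y = sum_outer (dim_row Y) (dim_col Y) m s x y)"

text \<open>The matrix \<open>[x\<^sub>0, \<dots>, x\<^bsub>r-1\<^esub>]\<close> with \<open>d\<close> rows.\<close>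

definition first_cols :: "nat \<Rightarrow> nat \<Rightarrow> (nat \<Rightarrow> real vec) \<Rightarrow> real mat" where
  "first_cols d r x = mat_of_cols d (map x [0..<r])"

text \<open>The \<open>\<sigma>\<close>-algebra generated by a set of real-valued functions.\<close>

definition generated_by :: "'a measure \<Rightarrow> ('a \<Rightarrow> real) set \<Rightarrow> 'a set set" where
  "generated_by M F = sigma_sets (space M) {f -` A \<inter> space M | f A. f \<in> F \<and> A \<in> sets borel}"

definition weighted_loss :: "real mat \<Rightarrow> real mat \<Rightarrow> real mat \<Rightarrow> real mat \<Rightarrow> real" where
  "weighted_loss V W A X = (frob_norm (V * (A - X) * W\<^sup>T))\<^sup>2"

definition has_asymptotic_loss ::
  "'a measure \<Rightarrow> (nat \<Rightarrow> real mat) \<Rightarrow> (nat \<Rightarrow> real mat) \<Rightarrow>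
   (nat \<Rightarrow> 'a \<Rightarrow> real mat) \<Rightarrow> (nat \<Rightarrow> 'a \<Rightarrow> real mat) \<Rightarrow> real \<Rightarrow> bool" where
  "has_asymptotic_loss M V W A X l \<longleftrightarrow>
     (AE \<omega> in M. (\<lambda>n. weighted_loss (V n) (W n) (A n \<omega>) (X n \<omega>)) \<longlonglongrightarrow> l)"

text \<open>Meaningful only when the almost sure limit exists (it is then unique).\<close>

definition asymptotic_loss ::
  "'a measure \<Rightarrow> (nat \<Rightarrow> real mat) \<Rightarrow> (nat \<Rightarrow> real mat) \<Rightarrow>
   (nat \<Rightarrow> 'a \<Rightarrow> real mat) \<Rightarrow> (nat \<Rightarrow> 'a \<Rightarrow> real mat) \<Rightarrow> real" where
  "asymptotic_loss M V W A X = (THE l. has_asymptotic_loss M V W A X l)"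

text \<open>
  The spiked model. Realisations at stage \<open>n\<close>: \<open>u n \<omega> k\<close>, \<open>v n \<omega> k\<close> (\<open>k < r\<close>) are the signal
  vectors and \<open>G n \<omega>\<close> is the noise. All stages live on one probability space. Orthonormal signal
  vectors only exist when \<open>r \<le> p n\<close> and \<open>r \<le> n\<close>, which holds for all large \<open>n\<close>, so conditions on
  the signal are imposed for such \<open>n\<close> only. Deterministic signal vectors are the case where
  \<open>u n \<omega>\<close> and \<open>v n \<omega>\<close> do not depend on \<open>\<omega>\<close>.
\<close>

definition spiked_model ::
  "'a measure \<Rightarrow> (nat \<Rightarrow> nat) \<Rightarrow> real \<Rightarrow> nat \<Rightarrow> (nat \<Rightarrow> real) \<Rightarrow>
   (nat \<Rightarrow> 'a \<Rightarrow> nat \<Rightarrow> real vec) \<Rightarrow> (nat \<Rightarrow> 'a \<Rightarrow> nat \<Rightarrow> real vec) \<Rightarrow>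
   (nat \<Rightarrow> 'a \<Rightarrow> real mat) \<Rightarrow> bool" where
  "spiked_model M p \<gamma> r t u v G \<longleftrightarrow>
     prob_space M \<and>
     filterlim p at_top sequentially \<and>
     (\<lambda>n. real (p n) / real n) \<longlonglongrightarrow> \<gamma> \<and>
     (\<forall>j<r. \<forall>k<r. j < k \<longrightarrow> t k < t j) \<and> (\<forall>k<r. 0 < t k) \<and>
     (\<forall>n. r \<le> p n \<and> r \<le> n \<longrightarrow>
        (\<forall>\<omega>\<in>space M. orthonormal_family (p n) r (u n \<omega>) \<and> orthonormal_family n r (v n \<omega>)) \<and>
        prob_space.indep_set M
          (generated_by M ({\<lambda>\<omega>. u n \<omega> k $ i | k i. k < r \<and> i < p n} \<union>
                           {\<lambda>\<omega>. v n \<omega> k $ j | k j. k < r \<and> j < n}))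
          (generated_by M {\<lambda>\<omega>. G n \<omega> $$ (i, j) | i j. i < p n \<and> j < n})) \<and>
     (\<forall>n. (\<forall>\<omega>\<in>space M. G n \<omega> \<in> carrier_mat (p n) n) \<and>
        (\<forall>i<p n. \<forall>j<n. distributed M lborel (\<lambda>\<omega>. G n \<omega> $$ (i, j))
                         (normal_density 0 (sqrt (1 / real n)))) \<and>
        prob_space.indep_vars M (\<lambda>_. borel) (\<lambda>ij \<omega>. G n \<omega> $$ ij) ({..<p n} \<times> {..<n}))"

end

theory Submission
  imports Defs "Jordan_Normal_Form.Determinant"
begin

text \<open>
  Why the theorem holds. Write \<open>T\<close> for the diagonal matrix of the \<open>t\<^sub>k\<close>, and let
  \<open>a = \<Omega> [uh\<^sub>k]\<close>, \<open>b = \<Omega> [u\<^sub>k]\<close> collect the weighted empirical and true left singular vectors,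
  and \<open>a'\<close>, \<open>b'\<close> the right ones. The weighted error of the estimator with coefficients \<open>B\<close> is
  \<open>a B a'\<^sup>T - b T b'\<^sup>T\<close>. When its squared Frobenius norm is expanded, cyclicity of the trace leaves only the
  \<open>r \<times> r\<close> Gram matrices of \<open>a\<close>, \<open>b\<close> and of \<open>a'\<close>, \<open>b'\<close>, whose almost sure limits are given. So the loss
  converges to
  \<open>\<langle>B, D B D'\<rangle> - 2 \<langle>B, C T C'\<^sup>T\<rangle> + \<langle>T, E T E'\<rangle>\<close>  (\<open>weighted_product_loss_tendsto\<close>).

  This is a quadratic function of \<open>B\<close> whose leading form is a limit of squared norms, hence nonnegative
  (\<open>gram_limit_sandwich_nonneg\<close>). Every solution of the normal equation \<open>D B D' = C T C'\<^sup>T\<close> is therefore a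
  minimizer (\<open>quadratic_loss_minimum\<close>). The matrix \<open>D\<^sup>+ C T C'\<^sup>T D'\<^sup>+\<close> is a solution provided that the
  columns of \<open>C\<close> lie in the range of \<open>D\<close>, and those of \<open>C'\<close> in the range of \<open>D'\<close>. This is the only
  delicate point, since \<open>D\<close> and \<open>D'\<close> may be singular. It holds because \<open>D\<close>, \<open>C\<close>, \<open>E\<close> are blocks of
  one limit of Gram matrices: a vector in the kernel of \<open>D\<close> is, by the Cauchy-Schwarz inequality in the
  limit, orthogonal to the columns of \<open>C\<close> (\<open>gram_limit_cross_range\<close>, \<open>gram_limit_pinv\<close>). Inserting
  the solution into the quadratic function gives the value (\<open>pinv_coefficients_value\<close>).

  The pseudoinverse is defined by a definite description, so its existence and uniqueness have to be
  shown for the symmetric matrices \<open>D\<close> and \<open>D'\<close>. It is obtained as a polynomial in the matrix, from an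
  annihilating polynomial (\<open>is_pseudoinverse_pinv_of_symmetric\<close>).
\<close>

section \<open>The Frobenius inner product of real matrices\<close>

text \<open>
  Side conditions on dimensions, unlike membership in \<open>carrier_mat\<close>, contain no dimension variable that
  the simplifier would have to guess, so the following two rules rewrite long products unaided.
\<close>

lemma mult_mat_assoc_dim:
  fixes A :: "'a :: semiring_0 mat"
  assumes "dim_col A = dim_row B" "dim_col B = dim_row C"
  shows "A * B * C = A * (B * C)"
  by (rule assoc_mult_mat[OF carrier_matI[OF refl refl] carrier_matI[OF assms(1)[symmetric] refl]
        carrier_matI[OF assms(2)[symmetric] refl]])

lemma transpose_mult_dim:
  fixes A :: "'a :: comm_semiring_0 mat"
  assumes "dim_col A = dim_row B"
  shows "(A * B)\<^sup>T = B\<^sup>T * A\<^sup>T"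
  by (rule transpose_mult[OF carrier_matI[OF refl refl] carrier_matI[OF assms[symmetric] refl]])

lemma index_transpose_mult:
  fixes A :: "'a :: semiring_0 mat"
  assumes "i < dim_col A" "j < dim_col B"
  shows "(A\<^sup>T * B) $$ (i, j) = col A i \<bullet> col B j"
  using assms by simp

lemma mat_trace_comm:
  assumes "A \<in> carrier_mat m n" "B \<in> carrier_mat n m"
  shows "mat_trace (A * B) = mat_trace (B * A)"
proof -
  have "mat_trace (A * B) = (\<Sum>i<m. \<Sum>j<n. A $$ (i, j) * B $$ (j, i))"
    using assms unfolding mat_trace_def
    by (intro sum.cong) (auto simp: scalar_prod_def lessThan_atLeast0)
  also have "\<dots> = (\<Sum>j<n. \<Sum>i<m. B $$ (j, i) * A $$ (i, j))"
    by (subst sum.swap) (simp add: mult.commute)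
  also have "\<dots> = mat_trace (B * A)"
    using assms unfolding mat_trace_def
    by (intro sum.cong) (auto simp: scalar_prod_def lessThan_atLeast0)
  finally show ?thesis .
qed

lemma frob_inner_entries:
  assumes "A \<in> carrier_mat m n" "B \<in> carrier_mat m n"
  shows "frob_inner A B = (\<Sum>j<n. \<Sum>i<m. A $$ (i, j) * B $$ (i, j))"
  using assms unfolding frob_inner_def mat_trace_def
  by (intro sum.cong) (auto simp: scalar_prod_def lessThan_atLeast0)

lemma frob_inner_commute:
  assumes "A \<in> carrier_mat m n" "B \<in> carrier_mat m n"
  shows "frob_inner A B = frob_inner B A"
  using assms by (simp add: frob_inner_entries mult.commute)

lemma frob_inner_self_nonneg: "0 \<le> frob_inner A A"
  by (subst frob_inner_entries[of A "dim_row A" "dim_col A"]) (auto intro!: sum_nonneg)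

lemma frob_norm_square: "(frob_norm A)\<^sup>2 = frob_inner A A"
  by (simp add: frob_norm_def frob_inner_self_nonneg)

lemma frob_inner_minus_left:
  assumes "A \<in> carrier_mat m n" "B \<in> carrier_mat m n" "C \<in> carrier_mat m n"
  shows "frob_inner (A - B) C = frob_inner A C - frob_inner B C"
  using assms
  by (simp add: frob_inner_entries[of _ m n] minus_carrier_mat algebra_simps sum_subtractf)

lemma frob_inner_minus_right:
  assumes "A \<in> carrier_mat m n" "B \<in> carrier_mat m n" "C \<in> carrier_mat m n"
  shows "frob_inner C (A - B) = frob_inner C A - frob_inner C B"
  using assms
  by (simp add: frob_inner_entries[of _ m n] minus_carrier_mat algebra_simps sum_subtractf)

lemma frob_norm_diff_square:
  assumes "A \<in> carrier_mat m n" "B \<in> carrier_mat m n"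
  shows "(frob_norm (A - B))\<^sup>2 = frob_inner A A - 2 * frob_inner A B + frob_inner B B"
proof -
  have "frob_inner B A = frob_inner A B"
    using assms by (rule frob_inner_commute[rotated])
  then show ?thesis
    using assms
    by (simp add: frob_norm_square frob_inner_minus_left[of _ m n]
        frob_inner_minus_right[of _ m n] minus_carrier_mat)
qed

text \<open>
  Cyclicity of the trace: the map \<open>Z \<mapsto> P Z Q\<^sup>T\<close> has adjoint \<open>W \<mapsto> P\<^sup>T W Q\<close>. This is what turns inner
  products in growing dimensions into inner products of fixed-size matrices.
\<close>

lemma frob_inner_adjoint:
  assumes "P \<in> carrier_mat m k" "Z \<in> carrier_mat k l" "Q \<in> carrier_mat n l" "W \<in> carrier_mat m n"
  shows "frob_inner (P * Z * Q\<^sup>T) W = frob_inner Z (P\<^sup>T * W * Q)"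
proof -
  have "frob_inner (P * Z * Q\<^sup>T) W = mat_trace (Q * (Z\<^sup>T * (P\<^sup>T * W)))"
    using assms unfolding frob_inner_def
    by (simp add: transpose_mult_dim mult_mat_assoc_dim del: assoc_mult_mat)
  also have "\<dots> = mat_trace ((Z\<^sup>T * (P\<^sup>T * W)) * Q)"
    by (rule mat_trace_comm[of _ n l]) (use assms in auto)
  also have "\<dots> = frob_inner Z (P\<^sup>T * W * Q)"
    using assms unfolding frob_inner_def by (simp add: mult_mat_assoc_dim del: assoc_mult_mat)
  finally show ?thesis .
qed

lemma frob_inner_factored:
  assumes "a \<in> carrier_mat m k" "B \<in> carrier_mat k l" "a' \<in> carrier_mat n l"
    and "b \<in> carrier_mat m k'" "T \<in> carrier_mat k' l'" "b' \<in> carrier_mat n l'"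
  shows "frob_inner (a * B * a'\<^sup>T) (b * T * b'\<^sup>T) = frob_inner B ((a\<^sup>T * b) * T * (a'\<^sup>T * b')\<^sup>T)"
  using assms
  by (subst frob_inner_adjoint[of _ m k _ l _ n])
     (auto simp add: transpose_mult_dim mult_mat_assoc_dim simp del: assoc_mult_mat)

section \<open>The pseudoinverse of a symmetric matrix\<close>

text \<open>
  The entries of \<open>(D X)\<^sup>T (D X) = X\<^sup>T D (D X) = 0\<close> on the diagonal are the squared column norms of \<open>D X\<close>.
  So a power \<open>D\<^sup>k\<close> with \<open>k \<ge> 1\<close> on the left of a vanishing product can be lowered to \<open>D\<close>.
\<close>

lemma mult_self_symmetric_cancel:
  fixes D X :: "real mat"
  assumes D: "D\<^sup>T = D" and dim: "dim_col D = dim_row X" and zero: "D * (D * X) = 0\<^sub>m (dim_row D) (dim_col X)"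
  shows "D * X = 0\<^sub>m (dim_row D) (dim_col X)"
proof -
  let ?A = "D * X"
  have sq: "dim_row D = dim_col D" using D by (metis index_transpose_mat(2))
  have "?A\<^sup>T * ?A = X\<^sup>T * (D * (D * X))"
    using dim sq D by (simp add: transpose_mult_dim mult_mat_assoc_dim del: assoc_mult_mat)
  also have "\<dots> = 0\<^sub>m (dim_col X) (dim_col X)"
    using dim sq zero by (simp add: right_mult_zero_mat)
  finally have "frob_inner ?A ?A = 0"
    by (simp add: frob_inner_def mat_trace_def)
  then have "(\<Sum>j<dim_col X. \<Sum>i<dim_row D. ?A $$ (i, j) * ?A $$ (i, j)) = 0"
    by (subst (asm) frob_inner_entries[of _ "dim_row D" "dim_col X"]) auto
  then have "\<forall>j<dim_col X. \<forall>i<dim_row D. ?A $$ (i, j) = 0"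
    by (auto simp: sum_nonneg_eq_0_iff sum_nonneg simp del: index_mult_mat)
  then show ?thesis by (intro eq_matI) (auto simp del: index_mult_mat(1))
qed

text \<open>
  Penrose's argument: the two projections onto the range of \<open>A\<close> agree, since each absorbs the other on
  one side and both are symmetric; likewise for the two projections \<open>X A\<close> and \<open>Y A\<close>. Then
  \<open>X = X A X = Y A X = Y A Y = Y\<close>.
\<close>

lemma is_pseudoinverse_unique:
  assumes X: "is_pseudoinverse A X" and Y: "is_pseudoinverse A Y"
  shows "X = Y"
proof -
  have dX: "dim_row X = dim_col A" "dim_col X = dim_row A"
    and dY: "dim_row Y = dim_col A" "dim_col Y = dim_row A"
    using X Y by (auto simp: is_pseudoinverse_def)
  have X1: "A * X * A = A" and X2: "X * A * X = X" and X3: "(A * X)\<^sup>T = A * X"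
    and X4: "(X * A)\<^sup>T = X * A" using X by (auto simp: is_pseudoinverse_def)
  have Y1: "A * Y * A = A" and Y2: "Y * A * Y = Y" and Y3: "(A * Y)\<^sup>T = A * Y"
    and Y4: "(Y * A)\<^sup>T = Y * A" using Y by (auto simp: is_pseudoinverse_def)
  have "A * X = (A * Y * A) * X" by (simp only: Y1)
  also have "\<dots> = (A * Y) * (A * X)" by (rule mult_mat_assoc_dim) (simp_all add: dX dY)
  also have "\<dots> = (A * Y)\<^sup>T * (A * X)\<^sup>T" by (simp only: X3 Y3)
  also have "\<dots> = ((A * X) * (A * Y))\<^sup>T"
    by (rule transpose_mult_dim[symmetric]) (simp add: dX)
  also have "(A * X) * (A * Y) = (A * X * A) * Y"
    by (rule mult_mat_assoc_dim[symmetric]) (simp_all add: dX dY)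
  also have "\<dots>\<^sup>T = A * Y" by (simp only: X1 Y3)
  finally have 1: "A * X = A * Y" .
  have "X * A = X * (A * Y * A)" by (simp only: Y1)
  also have "\<dots> = (X * A) * (Y * A)" by (simp add: mult_mat_assoc_dim dX dY del: assoc_mult_mat)
  also have "\<dots> = (X * A)\<^sup>T * (Y * A)\<^sup>T" by (simp only: X4 Y4)
  also have "\<dots> = ((Y * A) * (X * A))\<^sup>T"
    by (rule transpose_mult_dim[symmetric]) (simp add: dX)
  also have "(Y * A) * (X * A) = Y * (A * X * A)"
    by (simp add: mult_mat_assoc_dim dX dY del: assoc_mult_mat)
  also have "\<dots>\<^sup>T = Y * A" by (simp only: X1 Y4)
  finally have 2: "X * A = Y * A" .
  have "X = (X * A) * X" by (simp only: X2)
  also have "\<dots> = (Y * A) * X" by (simp only: 2)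
  also have "\<dots> = Y * (A * X)" by (rule mult_mat_assoc_dim) (simp_all add: dX dY)
  also have "\<dots> = Y * (A * Y)" by (simp only: 1)
  also have "\<dots> = (Y * A) * Y" by (rule mult_mat_assoc_dim[symmetric]) (simp_all add: dX dY)
  also have "\<dots> = Y" by (simp only: Y2)
  finally show ?thesis .
qed

text \<open>
  Evaluation of a polynomial, given by its coefficients in increasing degree, at a square matrix. The
  recursive form exposes the constant coefficient, on which the construction of an inverse depends.
\<close>

primrec mat_horner :: "real mat \<Rightarrow> real list \<Rightarrow> real mat" where
  "mat_horner D [] = 0\<^sub>m (dim_row D) (dim_row D)"
| "mat_horner D (c # cs) = c \<cdot>\<^sub>m 1\<^sub>m (dim_row D) + D * mat_horner D cs"

lemma mat_horner_carrier:
  "D \<in> carrier_mat r r \<Longrightarrow> mat_horner D cs \<in> carrier_mat r r"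
  by (induction cs) auto

lemma mat_horner_commute:
  assumes D: "D \<in> carrier_mat r r"
  shows "mat_horner D cs * D = D * mat_horner D cs"
proof (induction cs)
  case Nil
  then show ?case using D by auto
next
  case (Cons c cs)
  let ?H = "mat_horner D cs"
  have H: "?H \<in> carrier_mat r r" by (rule mat_horner_carrier[OF D])
  have "(c \<cdot>\<^sub>m 1\<^sub>m r + D * ?H) * D = c \<cdot>\<^sub>m D + D * (?H * D)"
    using D H by (subst add_mult_distrib_mat[of _ r r]) auto
  also have "\<dots> = D * (c \<cdot>\<^sub>m 1\<^sub>m r + D * ?H)"
    unfolding Cons.IH using D H
    by (subst mult_add_distrib_mat[of _ r r]) (auto simp: mult_smult_distrib[of _ r r])
  finally show ?case using D by simp
qed

lemma mat_horner_symmetric: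
  assumes D: "D \<in> carrier_mat r r" and sym: "D\<^sup>T = D"
  shows "(mat_horner D cs)\<^sup>T = mat_horner D cs"
proof (induction cs)
  case Nil
  then show ?case using D by auto
next
  case (Cons c cs)
  let ?H = "mat_horner D cs"
  have H: "?H \<in> carrier_mat r r" by (rule mat_horner_carrier[OF D])
  have "(D * ?H)\<^sup>T = ?H\<^sup>T * D\<^sup>T" using D H by (intro transpose_mult_dim) auto
  also have "\<dots> = D * ?H" unfolding Cons.IH sym by (rule mat_horner_commute[OF D])
  finally have "(D * ?H)\<^sup>T = D * ?H" .
  then have "(c \<cdot>\<^sub>m 1\<^sub>m r + D * ?H)\<^sup>T = c \<cdot>\<^sub>m 1\<^sub>m r + D * ?H"
    using D H by (subst transpose_add[of _ r r]) (auto intro!: eq_matI)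
  then show ?case using D by simp
qed

lemma mat_horner_entry:
  assumes D: "D \<in> carrier_mat r r" and "i < r" "j < r"
  shows "mat_horner D cs $$ (i, j)
    = (\<Sum>k<length cs. cs ! k * ((\<lambda>A. D * A) ^^ k) (1\<^sub>m r) $$ (i, j))"
  using assms(2)
proof (induction cs arbitrary: i)
  case Nil
  then show ?case using D \<open>j < r\<close> by auto
next
  case (Cons c cs)
  let ?F = "\<lambda>k. ((\<lambda>A. D * A) ^^ k) (1\<^sub>m r)"
  have F: "?F k \<in> carrier_mat r r" for k
    by (induction k) (use D in auto)
  have H: "mat_horner D cs \<in> carrier_mat r r" by (rule mat_horner_carrier[OF D])
  have mult: "(D * A) $$ (i, j) = (\<Sum>l<r. D $$ (i, l) * A $$ (l, j))"
    if "A \<in> carrier_mat r r" for A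
    using that D Cons.prems \<open>j < r\<close> by (auto simp: scalar_prod_def lessThan_atLeast0)
  have "(D * mat_horner D cs) $$ (i, j)
      = (\<Sum>l<r. \<Sum>k<length cs. cs ! k * (D $$ (i, l) * ?F k $$ (l, j)))"
    by (simp add: mult[OF H] Cons.IH sum_distrib_left mult.left_commute)
  also have "\<dots> = (\<Sum>k<length cs. \<Sum>l<r. cs ! k * (D $$ (i, l) * ?F k $$ (l, j)))"
    by (rule sum.swap)
  also have "\<dots> = (\<Sum>k<length cs. cs ! k * ?F (Suc k) $$ (i, j))"
    by (simp add: mult[OF F] sum_distrib_left del: index_mult_mat)
  finally have "(D * mat_horner D cs) $$ (i, j)
      = (\<Sum>k<length cs. cs ! k * ?F (Suc k) $$ (i, j))" .
  then show ?case
    using D H Cons.prems \<open>j < r\<close>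
    by (simp add: sum.lessThan_Suc_shift del: index_mult_mat(1) funpow.simps sum.lessThan_Suc)
qed

text \<open>
  The \<open>r\<^sup>2 + 1\<close> powers \<open>D\<^sup>0, \<dots>, D\<^bsup>r\<^sup>2\<^esup>\<close>, flattened to vectors with \<open>r\<^sup>2\<close> entries, are linearly dependent.
  To see this, put them into the columns of a square matrix whose last row is zero; its determinant
  vanishes, and a kernel vector lists the coefficients of a polynomial that annihilates \<open>D\<close>.
\<close>

lemma exists_annihilating_mat_horner:
  assumes D: "D \<in> carrier_mat r r"
  shows "\<exists>cs. (\<exists>c\<in>set cs. c \<noteq> 0) \<and> mat_horner D cs = 0\<^sub>m r r"
proof -
  define N where "N = Suc (r * r)"
  define F where "F k = ((\<lambda>A. D * A) ^^ k) (1\<^sub>m r)" for k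
  \<comment> \<open>Row \<open>i * r + j\<close> holds the \<open>(i, j)\<close> entries of all powers; the one extra row is zero.\<close>
  define K where "K = Matrix.mat N N
    (\<lambda>(a, k). if a < r * r then F k $$ (a div r, a mod r) else 0)"
  have K: "K \<in> carrier_mat N N" by (simp add: K_def)
  have "K\<^sup>T *\<^sub>v unit_vec N (r * r) = 0\<^sub>v N"
    by (intro eq_vecI) (auto simp: K_def N_def row_transpose)
  moreover have "unit_vec N (r * r) \<noteq> (0\<^sub>v N :: real vec)"
    by (simp add: N_def)
  ultimately have "det K\<^sup>T = 0"
    using K by (subst det_0_iff_vec_prod_zero[of _ N]) (auto intro!: exI[of _ "unit_vec N (r * r)"])
  then have "det K = 0" by (simp add: det_transpose[OF K])
  then obtain w where w: "w \<in> carrier_vec N" "w \<noteq> 0\<^sub>v N" "K *\<^sub>v w = 0\<^sub>v N"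
    using det_0_iff_vec_prod_zero[OF K] by auto
  define cs where "cs = list_of_vec w"
  have len: "length cs = N" and nth: "\<And>k. k < N \<Longrightarrow> cs ! k = w $ k"
    using w(1) by (auto simp: cs_def list_of_vec_index)
  have "\<exists>k<N. w $ k \<noteq> 0"
    using w(1,2) by (metis eq_vecI carrier_vecD index_zero_vec)
  then have "\<exists>c\<in>set cs. c \<noteq> 0" by (metis len nth nth_mem)
  moreover have "mat_horner D cs = 0\<^sub>m r r"
  proof (rule eq_matI)
    fix i j assume "i < dim_row (0\<^sub>m r r :: real mat)" "j < dim_col (0\<^sub>m r r :: real mat)"
    then have ij: "i < r" "j < r" by auto
    let ?a = "i * r + j"
    have a: "?a < r * r"
    proof -
      have "?a < Suc i * r" using ij by simp
      also have "\<dots> \<le> r * r" using ij by (intro mult_right_mono) auto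
      finally show ?thesis .
    qed
    have "?a div r = i" "?a mod r = j" using ij by auto
    then have "(K *\<^sub>v w) $ ?a = (\<Sum>k<N. F k $$ (i, j) * w $ k)"
      using a w(1) by (auto simp: K_def N_def scalar_prod_def lessThan_atLeast0 intro!: sum.cong)
    also have "\<dots> = mat_horner D cs $$ (i, j)"
      unfolding mat_horner_entry[OF D ij] len F_def by (intro sum.cong) (auto simp: nth)
    finally show "mat_horner D cs $$ (i, j) = 0\<^sub>m r r $$ (i, j)"
      using a ij by (simp add: w(3) N_def)
  qed (use mat_horner_carrier[OF D] in auto)
  ultimately show ?thesis by blast
qed

text \<open>
  Let \<open>f\<close> be a nonzero polynomial with \<open>D f(D) = 0\<close>. If its constant coefficient \<open>c\<close> is nonzero, write
  \<open>f(x) = c + x h(x)\<close>; then \<open>D (- h(D) / c) D = D\<close>, and a polynomial in \<open>D\<close> is symmetric and commutes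
  with \<open>D\<close>. If \<open>c = 0\<close>, then \<open>D\<^sup>2 h(D) = 0\<close>, and symmetry of \<open>D\<close> gives \<open>D h(D) = 0\<close>, so \<open>h\<close> may take
  the place of \<open>f\<close>.
\<close>

lemma symmetric_inner_inverse_of_mat_horner:
  assumes D: "D \<in> carrier_mat r r" and sym: "D\<^sup>T = D"
    and "\<exists>c\<in>set cs. c \<noteq> 0" "D * mat_horner D cs = 0\<^sub>m r r"
  shows "\<exists>Q\<in>carrier_mat r r. Q\<^sup>T = Q \<and> Q * D = D * Q \<and> D * Q * D = D"
  using assms(3,4)
proof (induction cs)
  case Nil
  then show ?case by simp
next
  case (Cons c cs)
  let ?H = "mat_horner D cs"
  have H: "?H \<in> carrier_mat r r" by (rule mat_horner_carrier[OF D])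
  have "D * (c \<cdot>\<^sub>m 1\<^sub>m r + D * ?H) = c \<cdot>\<^sub>m D + D * (D * ?H)"
    using D H by (subst mult_add_distrib_mat[of _ r r]) (auto simp: mult_smult_distrib[of _ r r])
  then have zero: "c \<cdot>\<^sub>m D + D * (D * ?H) = 0\<^sub>m r r"
    using Cons.prems(2) D by simp
  show ?case
  proof (cases "c = 0")
    case True
    have "D * (D * ?H) = 0\<^sub>m r r"
    proof (rule eq_matI)
      fix i j assume "i < dim_row (0\<^sub>m r r :: real mat)" "j < dim_col (0\<^sub>m r r :: real mat)"
      then show "(D * (D * ?H)) $$ (i, j) = 0\<^sub>m r r $$ (i, j)"
        using arg_cong[OF zero, of "\<lambda>A. A $$ (i, j)"] D H True by (simp del: index_mult_mat(1))
    qed (use D H in auto)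
    then have "D * ?H = 0\<^sub>m r r"
      using mult_self_symmetric_cancel[OF sym, of ?H] D H by auto
    moreover have "\<exists>c\<in>set cs. c \<noteq> 0" using Cons.prems(1) True by simp
    ultimately show ?thesis using Cons.IH by blast
  next
    case False
    have "(- 1 / c) \<cdot>\<^sub>m (D * (D * ?H)) = D"
    proof (rule eq_matI)
      fix i j assume ij: "i < dim_row D" "j < dim_col D"
      then have "c * D $$ (i, j) + (D * (D * ?H)) $$ (i, j) = 0"
        using arg_cong[OF zero, of "\<lambda>A. A $$ (i, j)"] D H by (simp del: index_mult_mat(1))
      then show "((- 1 / c) \<cdot>\<^sub>m (D * (D * ?H))) $$ (i, j) = D $$ (i, j)"
        using ij D H False by (simp del: index_mult_mat(1) add: field_simps add_eq_0_iff)
    qed (use D H in auto)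
    moreover define Q where "Q = (- 1 / c) \<cdot>\<^sub>m ?H"
    have Q: "Q \<in> carrier_mat r r" using H by (simp add: Q_def)
    have comm: "Q * D = D * Q"
      using D H mat_horner_commute[OF D, of cs]
      by (simp add: Q_def mult_smult_distrib[of _ r r] mult_smult_assoc_mat[of _ r r])
    moreover have "D * Q * D = (- 1 / c) \<cdot>\<^sub>m (D * (D * ?H))"
    proof -
      have "D * Q * D = D * (D * Q)"
        using D Q by (simp add: comm)
      also have "\<dots> = (- 1 / c) \<cdot>\<^sub>m (D * (D * ?H))"
        using D H unfolding Q_def
        by (simp add: mult_smult_distrib[OF D H] mult_smult_distrib[OF D mult_carrier_mat[OF D H]])
      finally show ?thesis .
    qed
    moreover have "Q\<^sup>T = Q"
    proof (rule eq_matI)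
      fix i j assume ij: "i < dim_row Q" "j < dim_col Q"
      have "?H\<^sup>T $$ (i, j) = ?H $$ (i, j)" by (simp only: mat_horner_symmetric[OF D sym])
      then show "Q\<^sup>T $$ (i, j) = Q $$ (i, j)"
        using ij Q H by (simp add: Q_def)
    qed (use Q in auto)
    ultimately show ?thesis using Q by metis
  qed
qed

text \<open>
  If \<open>Q\<close> is symmetric, commutes with \<open>D\<close> and satisfies \<open>D Q D = D\<close>, then \<open>Q D Q\<close> is the pseudoinverse:
  its products with \<open>D\<close> on both sides equal \<open>D Q\<close>, which is symmetric.
\<close>

lemma symmetric_pseudoinverse_exists:
  assumes D: "D \<in> carrier_mat r r" and sym: "D\<^sup>T = D"
  shows "\<exists>X. is_pseudoinverse D X"
proof -
  note [simp del] = assoc_mult_mat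
  obtain cs where cs: "\<exists>c\<in>set cs. c \<noteq> 0" "mat_horner D cs = 0\<^sub>m r r"
    using exists_annihilating_mat_horner[OF D] by blast
  then have "D * mat_horner D cs = 0\<^sub>m r r" using D by simp
  then obtain Q where Q: "Q \<in> carrier_mat r r" and Qsym: "Q\<^sup>T = Q"
    and comm: "Q * D = D * Q" and DQD: "D * Q * D = D"
    using symmetric_inner_inverse_of_mat_horner[OF D sym cs(1)] by blast
  have dims: "dim_row D = r" "dim_col D = r" "dim_row Q = r" "dim_col Q = r"
    using D Q by auto
  have left: "D * (Q * D * Q) = D * Q"
  proof -
    have "D * (Q * D * Q) = (D * Q * D) * Q" by (simp add: mult_mat_assoc_dim dims)
    then show ?thesis by (simp only: DQD)
  qed
  have right: "(Q * D * Q) * D = D * Q"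
  proof -
    have "(Q * D * Q) * D = Q * (D * Q * D)" by (simp add: mult_mat_assoc_dim dims)
    then show ?thesis by (simp only: DQD comm)
  qed
  have DQsym: "(D * Q)\<^sup>T = D * Q"
  proof -
    have "(D * Q)\<^sup>T = Q\<^sup>T * D\<^sup>T" by (rule transpose_mult_dim) (simp add: dims)
    then show ?thesis by (simp only: sym Qsym comm)
  qed
  have "(Q * D * Q) * D * (Q * D * Q) = Q * (D * Q * D) * (Q * D * Q)"
    by (simp add: mult_mat_assoc_dim dims)
  also have "\<dots> = Q * D * (Q * D * Q)" by (simp only: DQD)
  also have "\<dots> = Q * (D * Q * D) * Q" by (simp add: mult_mat_assoc_dim dims)
  also have "\<dots> = Q * D * Q" by (simp only: DQD)
  finally have "(Q * D * Q) * D * (Q * D * Q) = Q * D * Q" .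
  moreover have "Q * D * Q \<in> carrier_mat r r" using D Q by (intro mult_carrier_mat)
  ultimately have "is_pseudoinverse D (Q * D * Q)"
    unfolding is_pseudoinverse_def left by (simp add: right DQsym DQD dims)
  then show ?thesis by blast
qed

lemma is_pseudoinverse_pinv_of_symmetric:
  assumes D: "D \<in> carrier_mat r r" and sym: "D\<^sup>T = D"
  shows "is_pseudoinverse D (pinv D)"
  unfolding pinv_def
  by (rule theI') (use symmetric_pseudoinverse_exists[OF assms] is_pseudoinverse_unique in blast)

lemma is_pseudoinverse_transpose:
  assumes X: "is_pseudoinverse A X"
  shows "is_pseudoinverse A\<^sup>T X\<^sup>T"
proof -
  have dX: "dim_row X = dim_col A" "dim_col X = dim_row A"
    and X1: "A * X * A = A" and X2: "X * A * X = X" and X3: "(A * X)\<^sup>T = A * X"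
    and X4: "(X * A)\<^sup>T = X * A" using X by (auto simp: is_pseudoinverse_def)
  have "A\<^sup>T * X\<^sup>T * A\<^sup>T = (A * X * A)\<^sup>T" "X\<^sup>T * A\<^sup>T * X\<^sup>T = (X * A * X)\<^sup>T"
    by (simp_all add: transpose_mult_dim mult_mat_assoc_dim dX del: assoc_mult_mat)
  moreover have "A\<^sup>T * X\<^sup>T = X * A" "X\<^sup>T * A\<^sup>T = A * X"
    using X3 X4 by (simp_all add: transpose_mult_dim dX)
  ultimately show ?thesis
    using X1 X2 X3 X4 dX unfolding is_pseudoinverse_def by auto
qed

section \<open>Entrywise limits of matrices\<close>

text \<open>
  Matrices of different sizes share one type, so the right dimensions have to be part of convergence.
\<close>

definition entrywise_tendsto :: "(nat \<Rightarrow> real mat) \<Rightarrow> real mat \<Rightarrow> bool" where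
  "entrywise_tendsto F L \<longleftrightarrow>
     (\<forall>\<^sub>F n in sequentially. F n \<in> carrier_mat (dim_row L) (dim_col L)) \<and>
     (\<forall>i<dim_row L. \<forall>j<dim_col L. (\<lambda>n. F n $$ (i, j)) \<longlonglongrightarrow> L $$ (i, j))"

lemma entrywise_tendsto_const: "entrywise_tendsto (\<lambda>_. A) A"
  by (simp add: entrywise_tendsto_def)

lemma entrywise_tendsto_unique:
  assumes "entrywise_tendsto F L" "entrywise_tendsto F K" "dim_row L = dim_row K" "dim_col L = dim_col K"
  shows "L = K"
proof (rule eq_matI)
  fix i j assume "i < dim_row K" "j < dim_col K"
  then have "(\<lambda>n. F n $$ (i, j)) \<longlonglongrightarrow> L $$ (i, j)" "(\<lambda>n. F n $$ (i, j)) \<longlonglongrightarrow> K $$ (i, j)"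
    using assms unfolding entrywise_tendsto_def by auto
  then show "L $$ (i, j) = K $$ (i, j)" by (rule LIMSEQ_unique)
qed (use assms in auto)

lemma entrywise_tendsto_transpose:
  assumes "entrywise_tendsto F L"
  shows "entrywise_tendsto (\<lambda>n. (F n)\<^sup>T) L\<^sup>T"
proof -
  have ev: "\<forall>\<^sub>F n in sequentially. F n \<in> carrier_mat (dim_row L) (dim_col L)"
    and lim: "\<And>i j. i < dim_row L \<Longrightarrow> j < dim_col L \<Longrightarrow> (\<lambda>n. F n $$ (i, j)) \<longlonglongrightarrow> L $$ (i, j)"
    using assms by (auto simp: entrywise_tendsto_def)
  have "(\<lambda>n. (F n)\<^sup>T $$ (i, j)) \<longlonglongrightarrow> L\<^sup>T $$ (i, j)" if "i < dim_col L" "j < dim_row L" for i j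
  proof (rule Lim_transform_eventually)
    show "(\<lambda>n. F n $$ (j, i)) \<longlonglongrightarrow> L\<^sup>T $$ (i, j)" using lim that by simp
    show "\<forall>\<^sub>F n in sequentially. F n $$ (j, i) = (F n)\<^sup>T $$ (i, j)"
      using ev that by (auto elim!: eventually_mono)
  qed
  moreover have "\<forall>\<^sub>F n in sequentially. (F n)\<^sup>T \<in> carrier_mat (dim_col L) (dim_row L)"
    using ev by (auto elim: eventually_mono)
  ultimately show ?thesis unfolding entrywise_tendsto_def by auto
qed

lemma entrywise_tendsto_mult:
  assumes F: "entrywise_tendsto F L" and G: "entrywise_tendsto G K" and dim: "dim_col L = dim_row K"
  shows "entrywise_tendsto (\<lambda>n. F n * G n) (L * K)"
proof -
  have ev: "\<forall>\<^sub>F n in sequentially. F n \<in> carrier_mat (dim_row L) (dim_col L) \<and>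
      G n \<in> carrier_mat (dim_row K) (dim_col K)"
    using F G unfolding entrywise_tendsto_def by (auto intro: eventually_conj)
  have "(\<lambda>n. (F n * G n) $$ (i, j)) \<longlonglongrightarrow> (L * K) $$ (i, j)"
    if ij: "i < dim_row L" "j < dim_col K" for i j
  proof (rule Lim_transform_eventually)
    show "\<forall>\<^sub>F n in sequentially.
        (\<Sum>l<dim_row K. F n $$ (i, l) * G n $$ (l, j)) = (F n * G n) $$ (i, j)"
      using ev ij dim by (auto elim!: eventually_mono simp: scalar_prod_def lessThan_atLeast0)
    have "(\<lambda>n. \<Sum>l<dim_row K. F n $$ (i, l) * G n $$ (l, j))
        \<longlonglongrightarrow> (\<Sum>l<dim_row K. L $$ (i, l) * K $$ (l, j))"
      using F G ij dim unfolding entrywise_tendsto_def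
      by (intro tendsto_sum tendsto_mult) auto
    then show "(\<lambda>n. \<Sum>l<dim_row K. F n $$ (i, l) * G n $$ (l, j)) \<longlonglongrightarrow> (L * K) $$ (i, j)"
      using ij dim by (simp add: scalar_prod_def lessThan_atLeast0)
  qed
  moreover have "\<forall>\<^sub>F n in sequentially. F n * G n \<in> carrier_mat (dim_row L) (dim_col K)"
    using ev by (auto elim!: eventually_mono)
  ultimately show ?thesis unfolding entrywise_tendsto_def by simp
qed

lemma frob_inner_tendsto:
  assumes F: "entrywise_tendsto F L" and G: "entrywise_tendsto G K"
    and dim: "dim_row L = dim_row K" "dim_col L = dim_col K"
  shows "(\<lambda>n. frob_inner (F n) (G n)) \<longlonglongrightarrow> frob_inner L K"
proof (rule Lim_transform_eventually)
  have ev: "\<forall>\<^sub>F n in sequentially. F n \<in> carrier_mat (dim_row L) (dim_col L) \<and>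
      G n \<in> carrier_mat (dim_row K) (dim_col K)"
    using F G unfolding entrywise_tendsto_def by (auto intro: eventually_conj)
  then show "\<forall>\<^sub>F n in sequentially.
      (\<Sum>j<dim_col L. \<Sum>i<dim_row L. F n $$ (i, j) * G n $$ (i, j)) = frob_inner (F n) (G n)"
    by (rule eventually_mono) (simp add: frob_inner_entries[of _ "dim_row L" "dim_col L"] dim)
  have "frob_inner L K = (\<Sum>j<dim_col L. \<Sum>i<dim_row L. L $$ (i, j) * K $$ (i, j))"
    by (rule frob_inner_entries) (auto simp: dim)
  then show "(\<lambda>n. \<Sum>j<dim_col L. \<Sum>i<dim_row L. F n $$ (i, j) * G n $$ (i, j))
      \<longlonglongrightarrow> frob_inner L K"
    using F G dim unfolding entrywise_tendsto_def
    by (auto intro!: tendsto_sum tendsto_mult)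
qed

section \<open>Limits of Gram matrices\<close>

lemma scalar_prod_Cauchy_Schwarz:
  fixes x y :: "real vec"
  assumes "x \<in> carrier_vec n" "y \<in> carrier_vec n"
  shows "(x \<bullet> y)\<^sup>2 \<le> (x \<bullet> x) * (y \<bullet> y)"
  using Cauchy_Schwarz_ineq_sum[of "\<lambda>i. x $ i" "\<lambda>i. y $ i" "{0..<n}"] assms
  by (simp add: scalar_prod_def power2_eq_square)

text \<open>
  The Gram matrix of the concatenation \<open>[a\<^sub>n, b\<^sub>n]\<close> converges to the block matrix with rows \<open>(D, C)\<close> and
  \<open>(C\<^sup>T, E)\<close>. The common number of rows of \<open>a\<^sub>n\<close> and \<open>b\<^sub>n\<close> may grow with \<open>n\<close>. All information about a
  realisation of the spiked model that the loss depends on is of this form, once for the left and once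
  for the right singular vectors.
\<close>

definition gram_limit ::
  "(nat \<Rightarrow> real mat) \<Rightarrow> (nat \<Rightarrow> real mat) \<Rightarrow> real mat \<Rightarrow> real mat \<Rightarrow> real mat \<Rightarrow> bool" where
  "gram_limit a b D C E \<longleftrightarrow>
     (\<forall>n. dim_row (a n) = dim_row (b n) \<and> dim_col (a n) = dim_row C \<and> dim_col (b n) = dim_col C) \<and>
     D \<in> carrier_mat (dim_row C) (dim_row C) \<and> E \<in> carrier_mat (dim_col C) (dim_col C) \<and>
     entrywise_tendsto (\<lambda>n. (a n)\<^sup>T * a n) D \<and>
     entrywise_tendsto (\<lambda>n. (a n)\<^sup>T * b n) C \<and>
     entrywise_tendsto (\<lambda>n. (b n)\<^sup>T * b n) E"

lemma gram_limit_symmetric: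
  assumes "gram_limit a b D C E"
  shows "D\<^sup>T = D" "E\<^sup>T = E"
proof -
  have sym: "K\<^sup>T = K" if "entrywise_tendsto (\<lambda>n. (x n)\<^sup>T * x n) K" "dim_row K = dim_col K" for x K
  proof (rule entrywise_tendsto_unique)
    have "((x n)\<^sup>T * x n)\<^sup>T = (x n)\<^sup>T * x n" for n
      by (simp add: transpose_mult_dim)
    then show "entrywise_tendsto (\<lambda>n. (x n)\<^sup>T * x n) K\<^sup>T"
      using entrywise_tendsto_transpose[OF that(1)] by simp
  qed (use that in auto)
  show "D\<^sup>T = D" "E\<^sup>T = E"
    using assms by (auto simp: gram_limit_def intro!: sym)
qed

text \<open>
  A limit of Gram matrices is positive semidefinite, and the kernel of a diagonal block of such a matrix
  annihilates the off-diagonal block. The Cauchy-Schwarz inequality passed to the limit shows this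
  directly: each column \<open>z\<close> of \<open>Z\<close> satisfies
  \<open>(z\<^sup>T C e\<^sub>k)\<^sup>2 = lim (a\<^sub>n z \<bullet> b\<^sub>n e\<^sub>k)\<^sup>2 \<le> lim |a\<^sub>n z|\<^sup>2 |b\<^sub>n e\<^sub>k|\<^sup>2 = (z\<^sup>T D z) E\<^sub>k\<^sub>k = 0\<close>.
\<close>

lemma gram_limit_cross_range:
  assumes lim: "gram_limit a b D C E" and Z: "dim_row Z = dim_row C"
    and DZ: "D * Z = 0\<^sub>m (dim_row C) (dim_col Z)"
  shows "Z\<^sup>T * C = 0\<^sub>m (dim_col Z) (dim_col C)"
proof (rule eq_matI)
  have dims: "\<And>n. dim_row (a n) = dim_row (b n)" "\<And>n. dim_col (a n) = dim_row C"
      "\<And>n. dim_col (b n) = dim_col C" "dim_row D = dim_row C" "dim_col D = dim_row C"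
      "dim_row E = dim_col C" "dim_col E = dim_col C"
    using lim by (auto simp: gram_limit_def)
  have a: "entrywise_tendsto (\<lambda>n. (a n)\<^sup>T * a n) D" and c: "entrywise_tendsto (\<lambda>n. (a n)\<^sup>T * b n) C"
    and b: "entrywise_tendsto (\<lambda>n. (b n)\<^sup>T * b n) E"
    using lim by (auto simp: gram_limit_def)
  have aZ: "entrywise_tendsto (\<lambda>n. Z\<^sup>T * ((a n)\<^sup>T * a n * Z)) (Z\<^sup>T * (D * Z))"
    by (intro entrywise_tendsto_mult a entrywise_tendsto_const) (auto simp: dims Z)
  have cZ: "entrywise_tendsto (\<lambda>n. Z\<^sup>T * ((a n)\<^sup>T * b n)) (Z\<^sup>T * C)"
    by (intro entrywise_tendsto_mult c entrywise_tendsto_const) (auto simp: dims Z)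
  fix j k assume "j < dim_row (0\<^sub>m (dim_col Z) (dim_col C) :: real mat)"
    "k < dim_col (0\<^sub>m (dim_col Z) (dim_col C) :: real mat)"
  then have jk: "j < dim_col Z" "k < dim_col C" by auto
  have bound: "((Z\<^sup>T * ((a n)\<^sup>T * b n)) $$ (j, k))\<^sup>2
      \<le> (Z\<^sup>T * ((a n)\<^sup>T * a n * Z)) $$ (j, j) * ((b n)\<^sup>T * b n) $$ (k, k)" for n
  proof -
    have "Z\<^sup>T * ((a n)\<^sup>T * b n) = (a n * Z)\<^sup>T * b n"
      and "Z\<^sup>T * ((a n)\<^sup>T * a n * Z) = (a n * Z)\<^sup>T * (a n * Z)"
      by (simp_all add: transpose_mult_dim mult_mat_assoc_dim dims Z del: assoc_mult_mat)
    then show ?thesis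
      using jk
      by (auto simp: index_transpose_mult dims simp del: index_mult_mat(1) col_mult2
          intro!: scalar_prod_Cauchy_Schwarz[of _ "dim_row (b n)"] carrier_vecI)
  qed
  have "((Z\<^sup>T * C) $$ (j, k))\<^sup>2 \<le> (Z\<^sup>T * (D * Z)) $$ (j, j) * E $$ (k, k)"
  proof (rule LIMSEQ_le)
    show "(\<lambda>n. ((Z\<^sup>T * ((a n)\<^sup>T * b n)) $$ (j, k))\<^sup>2) \<longlonglongrightarrow> ((Z\<^sup>T * C) $$ (j, k))\<^sup>2"
      using cZ jk unfolding entrywise_tendsto_def by (intro tendsto_power) auto
    show "(\<lambda>n. (Z\<^sup>T * ((a n)\<^sup>T * a n * Z)) $$ (j, j) * ((b n)\<^sup>T * b n) $$ (k, k))
        \<longlonglongrightarrow> (Z\<^sup>T * (D * Z)) $$ (j, j) * E $$ (k, k)"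
      using aZ b jk dims Z unfolding entrywise_tendsto_def
      by (intro tendsto_mult) (auto simp del: index_mult_mat(1))
  qed (use bound in auto)
  also have "(Z\<^sup>T * (D * Z)) $$ (j, j) = 0"
    unfolding DZ using jk Z by (simp add: right_mult_zero_mat)
  finally show "(Z\<^sup>T * C) $$ (j, k) = 0\<^sub>m (dim_col Z) (dim_col C) $$ (j, k)"
    using jk by simp
qed auto

text \<open>
  \<open>D D\<^sup>+\<close> is the orthogonal projection onto the range of \<open>D\<close>. By the preceding lemma, applied to the
  complementary projection \<open>1 - D D\<^sup>+\<close>, it fixes the columns of \<open>C\<close>. This holds even when the limit of the
  Gram matrices of the \<open>a\<^sub>n\<close> is singular.
\<close>

lemma gram_limit_pinv:
  assumes lim: "gram_limit a b D C E"
  shows "pinv D \<in> carrier_mat (dim_row C) (dim_row C)" "(pinv D)\<^sup>T = pinv D" "D * (pinv D * C) = C"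
proof -
  let ?r = "dim_row C" and ?P = "pinv D"
  have D: "D \<in> carrier_mat ?r ?r" using lim by (simp add: gram_limit_def)
  note sym = gram_limit_symmetric(1)[OF lim]
  have pinv: "is_pseudoinverse D ?P" by (rule is_pseudoinverse_pinv_of_symmetric[OF D sym])
  show P: "?P \<in> carrier_mat ?r ?r" using pinv D by (auto simp: is_pseudoinverse_def)
  have "is_pseudoinverse D ?P\<^sup>T" using is_pseudoinverse_transpose[OF pinv] by (simp only: sym)
  then show Psym: "?P\<^sup>T = ?P" using is_pseudoinverse_unique[OF _ pinv] by blast
  have DPD: "D * ?P * D = D" and DPsym: "(D * ?P)\<^sup>T = D * ?P"
    using pinv by (auto simp: is_pseudoinverse_def)
  have "(D * ?P)\<^sup>T = ?P\<^sup>T * D\<^sup>T" using D P by (intro transpose_mult_dim) auto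
  then have comm: "?P * D = D * ?P" by (simp only: DPsym Psym sym)
  define Z where "Z = 1\<^sub>m ?r - D * ?P"
  have "D * Z = D * 1\<^sub>m ?r - D * (D * ?P)"
    unfolding Z_def by (rule mult_minus_distrib_mat) (use D P in auto)
  also have "D * (D * ?P) = D * (?P * D)" by (simp only: comm)
  also have "\<dots> = D * ?P * D" using D P by simp
  finally have DZ: "D * Z = 0\<^sub>m ?r (dim_col Z)"
    using D P by (simp add: DPD Z_def)
  have ZT: "Z\<^sup>T = Z"
    unfolding Z_def using D P by (subst transpose_minus[of _ ?r ?r]) (auto simp: DPsym)
  have "Z * C = 1\<^sub>m ?r * C - D * ?P * C"
    unfolding Z_def by (rule minus_mult_distrib_mat) (use D P in auto)
  moreover have "Z * C = 0\<^sub>m ?r (dim_col C)"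
    using gram_limit_cross_range[OF lim _ DZ] D P by (simp add: ZT) (simp add: Z_def)
  ultimately have zero: "C - D * (?P * C) = 0\<^sub>m ?r (dim_col C)"
    using D P by (simp add: mult_mat_assoc_dim)
  show "D * (?P * C) = C"
  proof (rule eq_matI)
    fix i j assume "i < dim_row C" "j < dim_col C"
    then show "(D * (?P * C)) $$ (i, j) = C $$ (i, j)"
      using arg_cong[OF zero, of "\<lambda>A. A $$ (i, j)"] D P by (simp del: index_mult_mat(1))
  qed (use D P in auto)
qed

section \<open>The limiting loss as a quadratic function\<close>

lemma frob_inner_factored_tendsto:
  assumes K: "entrywise_tendsto (\<lambda>n. (x n)\<^sup>T * y n) K"
    and K': "entrywise_tendsto (\<lambda>n. (x' n)\<^sup>T * y' n) K'"
    and dims: "\<And>n. x n \<in> carrier_mat (m n) (dim_row K)" "\<And>n. y n \<in> carrier_mat (m n) (dim_col K)"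
      "\<And>n. x' n \<in> carrier_mat (m' n) (dim_row K')" "\<And>n. y' n \<in> carrier_mat (m' n) (dim_col K')"
    and B: "B \<in> carrier_mat (dim_row K) (dim_row K')"
    and T: "T \<in> carrier_mat (dim_col K) (dim_col K')"
  shows "(\<lambda>n. frob_inner (x n * B * (x' n)\<^sup>T) (y n * T * (y' n)\<^sup>T)) \<longlonglongrightarrow> frob_inner B (K * T * K'\<^sup>T)"
proof -
  have "frob_inner (x n * B * (x' n)\<^sup>T) (y n * T * (y' n)\<^sup>T)
      = frob_inner B (((x n)\<^sup>T * y n) * T * ((x' n)\<^sup>T * y' n)\<^sup>T)" for n
    by (rule frob_inner_factored[OF dims(1) B dims(3) dims(2) T dims(4)])
  moreover have "entrywise_tendsto (\<lambda>n. ((x n)\<^sup>T * y n) * T * ((x' n)\<^sup>T * y' n)\<^sup>T) (K * T * K'\<^sup>T)"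
    by (intro entrywise_tendsto_mult entrywise_tendsto_transpose entrywise_tendsto_const K K')
       (use T in auto)
  ultimately show ?thesis
    using B by (simp add: frob_inner_tendsto[OF entrywise_tendsto_const])
qed

lemma sandwich_carrier_mat:
  assumes "P \<in> carrier_mat m k" "Z \<in> carrier_mat k l" "Q \<in> carrier_mat n l"
  shows "P * Z * Q\<^sup>T \<in> carrier_mat m n"
  using assms by (intro mult_carrier_mat) auto

lemma weighted_product_loss_tendsto:
  assumes lim: "gram_limit a b D C E" and lim': "gram_limit a' b' D' C' E'"
    and B: "B \<in> carrier_mat (dim_row C) (dim_row C')"
    and T: "T \<in> carrier_mat (dim_col C) (dim_col C')"
  shows "(\<lambda>n. (frob_norm (a n * B * (a' n)\<^sup>T - b n * T * (b' n)\<^sup>T))\<^sup>2)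
    \<longlonglongrightarrow> frob_inner B (D * B * D') - 2 * frob_inner B (C * T * C'\<^sup>T) + frob_inner T (E * T * E')"
proof -
  let ?m = "\<lambda>n. dim_row (b n)" and ?m' = "\<lambda>n. dim_row (b' n)"
  have car: "\<And>n. a n \<in> carrier_mat (?m n) (dim_row C)" "\<And>n. b n \<in> carrier_mat (?m n) (dim_col C)"
      "\<And>n. a' n \<in> carrier_mat (?m' n) (dim_row C')" "\<And>n. b' n \<in> carrier_mat (?m' n) (dim_col C')"
    and D: "dim_row D = dim_row C" "dim_col D = dim_row C" "dim_row D' = dim_row C'" "dim_col D' = dim_row C'"
    and E: "dim_row E = dim_col C" "dim_col E = dim_col C" "dim_row E' = dim_col C'" "dim_col E' = dim_col C'"
    using lim lim' by (auto simp: gram_limit_def)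
  note entrywise = lim[unfolded gram_limit_def] lim'[unfolded gram_limit_def]
  have "(\<lambda>n. frob_inner (a n * B * (a' n)\<^sup>T) (a n * B * (a' n)\<^sup>T)) \<longlonglongrightarrow> frob_inner B (D * B * D'\<^sup>T)"
    by (rule frob_inner_factored_tendsto[where m = ?m and m' = ?m']) (use entrywise car D B in auto)
  moreover have "(\<lambda>n. frob_inner (a n * B * (a' n)\<^sup>T) (b n * T * (b' n)\<^sup>T)) \<longlonglongrightarrow> frob_inner B (C * T * C'\<^sup>T)"
    by (rule frob_inner_factored_tendsto[where m = ?m and m' = ?m']) (use entrywise car B T in auto)
  moreover have "(\<lambda>n. frob_inner (b n * T * (b' n)\<^sup>T) (b n * T * (b' n)\<^sup>T)) \<longlonglongrightarrow> frob_inner T (E * T * E'\<^sup>T)"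
    by (rule frob_inner_factored_tendsto[where m = ?m and m' = ?m']) (use entrywise car E T in auto)
  ultimately have "(\<lambda>n. frob_inner (a n * B * (a' n)\<^sup>T) (a n * B * (a' n)\<^sup>T)
        - 2 * frob_inner (a n * B * (a' n)\<^sup>T) (b n * T * (b' n)\<^sup>T)
        + frob_inner (b n * T * (b' n)\<^sup>T) (b n * T * (b' n)\<^sup>T))
      \<longlonglongrightarrow> frob_inner B (D * B * D'\<^sup>T) - 2 * frob_inner B (C * T * C'\<^sup>T) + frob_inner T (E * T * E'\<^sup>T)"
    by (intro tendsto_add tendsto_diff tendsto_mult tendsto_const)
  moreover have "(frob_norm (a n * B * (a' n)\<^sup>T - b n * T * (b' n)\<^sup>T))\<^sup>2
      = frob_inner (a n * B * (a' n)\<^sup>T) (a n * B * (a' n)\<^sup>T)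
        - 2 * frob_inner (a n * B * (a' n)\<^sup>T) (b n * T * (b' n)\<^sup>T)
        + frob_inner (b n * T * (b' n)\<^sup>T) (b n * T * (b' n)\<^sup>T)" for n
    by (rule frob_norm_diff_square[of _ "?m n" "?m' n"])
       (intro sandwich_carrier_mat[OF car(1) B car(3)] sandwich_carrier_mat[OF car(2) T car(4)])+
  ultimately show ?thesis
    by (simp add: gram_limit_symmetric[OF lim'])
qed

text \<open>
  The quadratic form \<open>H \<mapsto> \<langle>H, D H D'\<rangle>\<close> is the limit of the squared norms of \<open>a\<^sub>n H a'\<^sub>n\<^sup>T\<close>. Its
  nonnegativity makes the limiting loss a convex function of the coefficients.
\<close>

lemma gram_limit_sandwich_nonneg:
  assumes lim: "gram_limit a b D C E" and lim': "gram_limit a' b' D' C' E'"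
    and H: "H \<in> carrier_mat (dim_row C) (dim_row C')"
  shows "0 \<le> frob_inner H (D * H * D')"
proof -
  have "(\<lambda>n. frob_inner (a n * H * (a' n)\<^sup>T) (a n * H * (a' n)\<^sup>T)) \<longlonglongrightarrow> frob_inner H (D * H * D'\<^sup>T)"
    by (rule frob_inner_factored_tendsto[where m = "\<lambda>n. dim_row (b n)" and m' = "\<lambda>n. dim_row (b' n)"])
       (use lim lim' H in \<open>auto simp: gram_limit_def\<close>)
  then have "0 \<le> frob_inner H (D * H * D'\<^sup>T)"
    by (rule LIMSEQ_le_const) (auto simp: frob_inner_self_nonneg)
  then show ?thesis by (simp only: gram_limit_symmetric[OF lim'])
qed

text \<open>
  Completing the square: \<open>q(B) = q(B0) + \<langle>B - B0, D (B - B0) D'\<rangle>\<close> whenever \<open>B0\<close> solves the normal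
  equation \<open>D B0 D' = N\<close>.
\<close>

lemma quadratic_loss_minimum:
  assumes D: "D \<in> carrier_mat r r" "D\<^sup>T = D" and D': "D' \<in> carrier_mat s s" "D'\<^sup>T = D'"
    and psd: "\<And>H. H \<in> carrier_mat r s \<Longrightarrow> 0 \<le> frob_inner H (D * H * D')"
    and B: "B \<in> carrier_mat r s" and B0: "B0 \<in> carrier_mat r s" and crit: "D * B0 * D' = N"
  shows "frob_inner B0 (D * B0 * D') - 2 * frob_inner B0 N
    \<le> frob_inner B (D * B * D') - 2 * frob_inner B N"
proof -
  note [simp del] = assoc_mult_mat
  let ?H = "B - B0"
  have H: "?H \<in> carrier_mat r s" using B B0 by auto
  have DB: "D * B * D' \<in> carrier_mat r s" and DB0: "D * B0 * D' \<in> carrier_mat r s"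
    using D D' B B0 by auto
  have "D * ?H * D' = D * B * D' - D * B0 * D'"
    using D D' B B0
    by (simp add: mult_minus_distrib_mat[of _ r r] minus_mult_distrib_mat[of _ r s])
  then have "0 \<le> frob_inner ?H (D * B * D' - D * B0 * D')" using psd[OF H] by simp
  also have "\<dots> = frob_inner B (D * B * D') - frob_inner B (D * B0 * D')
      - frob_inner B0 (D * B * D') + frob_inner B0 (D * B0 * D')"
    using B B0 DB DB0 H
    by (simp add: frob_inner_minus_left[of _ r s] frob_inner_minus_right[of _ r s])
  also have "frob_inner B0 (D * B * D') = frob_inner (D * B0 * D'\<^sup>T) B"
    using D D' B B0 by (subst frob_inner_adjoint[of _ r r _ s _ s]) auto
  also have "\<dots> = frob_inner B (D * B0 * D')"
    unfolding D'(2) by (rule frob_inner_commute[OF DB0 B])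
  finally show ?thesis unfolding crit by simp
qed

text \<open>
  The proposed coefficients solve the normal equation, because \<open>D D\<^sup>+\<close> fixes \<open>C\<close> on the left and, after
  transposition, \<open>D'\<^sup>+ D'\<close> fixes \<open>C'\<^sup>T\<close> on the right.
\<close>

lemma pinv_coefficients_critical:
  assumes lim: "gram_limit a b D C E" and lim': "gram_limit a' b' D' C' E'"
    and T: "T \<in> carrier_mat (dim_col C) (dim_col C')"
  shows "D * (pinv D * C * T * C'\<^sup>T * pinv D') * D' = C * T * C'\<^sup>T"
proof -
  note [simp del] = assoc_mult_mat
  have dims: "dim_row D = dim_row C" "dim_col D = dim_row C" "dim_row D' = dim_row C'"
      "dim_col D' = dim_row C'" "dim_row (pinv D) = dim_row C" "dim_col (pinv D) = dim_row C"
      "dim_row (pinv D') = dim_row C'" "dim_col (pinv D') = dim_row C'"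
      "dim_row T = dim_col C" "dim_col T = dim_col C'"
    using lim lim' gram_limit_pinv(1)[OF lim] gram_limit_pinv(1)[OF lim'] T
    by (auto simp: gram_limit_def)
  have "C'\<^sup>T * pinv D' * D' = C'\<^sup>T * (pinv D')\<^sup>T * D'\<^sup>T"
    by (simp only: gram_limit_pinv(2)[OF lim'] gram_limit_symmetric(1)[OF lim'])
  also have "\<dots> = (D' * (pinv D' * C'))\<^sup>T"
    by (simp add: transpose_mult_dim dims)
  also have "\<dots> = C'\<^sup>T" by (simp only: gram_limit_pinv(3)[OF lim'])
  finally have right: "C'\<^sup>T * pinv D' * D' = C'\<^sup>T" .
  have "D * (pinv D * C * T * C'\<^sup>T * pinv D') * D' = (D * (pinv D * C)) * T * (C'\<^sup>T * pinv D' * D')"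
    by (simp add: mult_mat_assoc_dim dims)
  then show ?thesis by (simp only: right gram_limit_pinv(3)[OF lim])
qed

text \<open>
  At a solution of the normal equation the quadratic and the linear term of the loss combine to
  \<open>- \<langle>Bh, C T C'\<^sup>T\<rangle>\<close>, and the adjoint rule moves the outer factors \<open>C\<close> and \<open>C'\<^sup>T\<close> onto \<open>Bh\<close>.
\<close>

lemma pinv_coefficients_value:
  assumes lim: "gram_limit a b D C E" and lim': "gram_limit a' b' D' C' E'"
    and T: "T \<in> carrier_mat (dim_col C) (dim_col C')"
    and Bh: "Bh = pinv D * C * T * C'\<^sup>T * pinv D'"
  shows "frob_inner Bh (D * Bh * D') - 2 * frob_inner Bh (C * T * C'\<^sup>T) + frob_inner T (E * T * E')
    = frob_inner (E * T * E' - C\<^sup>T * pinv D * C * T * C'\<^sup>T * pinv D' * C') T"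
proof -
  note [simp del] = assoc_mult_mat
  let ?r = "dim_row C" and ?r' = "dim_row C'" and ?s = "dim_col C" and ?s' = "dim_col C'"
  have car: "C \<in> carrier_mat ?r ?s" "C' \<in> carrier_mat ?r' ?s'"
      "E \<in> carrier_mat ?s ?s" "E' \<in> carrier_mat ?s' ?s'"
    using lim lim' by (auto simp: gram_limit_def)
  note P = gram_limit_pinv(1)[OF lim] gram_limit_pinv(1)[OF lim']
  have Bh_car: "Bh \<in> carrier_mat ?r ?r'"
    unfolding Bh using car P T by (intro mult_carrier_mat) auto
  have cross: "C\<^sup>T * pinv D * C * T * C'\<^sup>T * pinv D' * C' = C\<^sup>T * Bh * C'"
    unfolding Bh using car P T by (simp add: mult_mat_assoc_dim)
  have "frob_inner (C\<^sup>T * Bh * C'\<^sup>T\<^sup>T) T = frob_inner Bh (C\<^sup>T\<^sup>T * T * C'\<^sup>T)"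
    by (rule frob_inner_adjoint[of _ ?s ?r _ ?r' _ ?s']) (use car Bh_car T in auto)
  then have adj: "frob_inner (C\<^sup>T * Bh * C') T = frob_inner Bh (C * T * C'\<^sup>T)" by simp
  have ETE: "E * T * E' \<in> carrier_mat ?s ?s'" and CBC: "C\<^sup>T * Bh * C' \<in> carrier_mat ?s ?s'"
    using car T Bh_car by (auto intro!: mult_carrier_mat)
  have "frob_inner (E * T * E' - C\<^sup>T * Bh * C') T
      = frob_inner T (E * T * E') - frob_inner Bh (C * T * C'\<^sup>T)"
    by (simp only: frob_inner_minus_left[OF ETE CBC T] adj frob_inner_commute[OF ETE T])
  moreover have "D * Bh * D' = C * T * C'\<^sup>T"
    unfolding Bh by (rule pinv_coefficients_critical[OF lim lim' T])
  ultimately show ?thesis unfolding cross by simp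
qed

section \<open>Reduction of the spiked model to Gram matrices\<close>

lemma first_cols_carrier: "first_cols d r x \<in> carrier_mat d r"
  unfolding first_cols_def using mat_of_cols_carrier(1)[of d "map x [0..<r]"] by simp

lemma sum_outer_factored:
  "sum_outer p n r t x y = first_cols p r x * mat_diag r t * (first_cols n r y)\<^sup>T"
proof -
  have "first_cols p r x * mat_diag r t = Matrix.mat p r (\<lambda>(i, k). first_cols p r x $$ (i, k) * t k)"
    by (rule mat_diag_mult_right[OF first_cols_carrier])
  then show ?thesis
    using first_cols_carrier[of n r y]
    by (intro eq_matI)
       (auto simp: sum_outer_def first_cols_def mat_of_cols_index scalar_prod_def lessThan_atLeast0
         mult.assoc mult.left_commute intro!: sum.cong)
qed

lemma weighted_gram_tendsto:
  assumes L: "L \<in> carrier_mat r r" and W: "\<And>n. dim_col (W n) = d n"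
    and vecs: "\<forall>\<^sub>F n in sequentially. \<forall>k<r. x n k \<in> carrier_vec (d n) \<and> y n k \<in> carrier_vec (d n)"
    and lim: "\<And>j k. j < r \<Longrightarrow> k < r \<Longrightarrow> (\<lambda>n. (W n *\<^sub>v x n j) \<bullet> (W n *\<^sub>v y n k)) \<longlonglongrightarrow> L $$ (j, k)"
  shows "entrywise_tendsto
    (\<lambda>n. (W n * first_cols (d n) r (x n))\<^sup>T * (W n * first_cols (d n) r (y n))) L"
proof -
  let ?F = "\<lambda>n. (W n * first_cols (d n) r (x n))\<^sup>T * (W n * first_cols (d n) r (y n))"
  have col: "col (W n * first_cols (d n) r z) j = W n *\<^sub>v z j"
    if "j < r" "z j \<in> carrier_vec (d n)" for n j z
  proof -
    have "col (first_cols (d n) r z) j = z j"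
      unfolding first_cols_def using that by (subst col_mat_of_cols) auto
    then show ?thesis
      using that W[of n] first_cols_carrier[of "d n" r z] by (subst col_mult2) auto
  qed
  have "(\<lambda>n. ?F n $$ (j, k)) \<longlonglongrightarrow> L $$ (j, k)" if jk: "j < r" "k < r" for j k
  proof (rule Lim_transform_eventually[OF lim[OF jk]])
    show "\<forall>\<^sub>F n in sequentially. (W n *\<^sub>v x n j) \<bullet> (W n *\<^sub>v y n k) = ?F n $$ (j, k)"
      using vecs
    proof (rule eventually_mono)
      fix n assume v: "\<forall>k<r. x n k \<in> carrier_vec (d n) \<and> y n k \<in> carrier_vec (d n)"
      have "?F n $$ (j, k)
          = col (W n * first_cols (d n) r (x n)) j \<bullet> col (W n * first_cols (d n) r (y n)) k"
        by (rule index_transpose_mult)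
           (use jk first_cols_carrier[of "d n" r "x n"] first_cols_carrier[of "d n" r "y n"] in auto)
      then show "(W n *\<^sub>v x n j) \<bullet> (W n *\<^sub>v y n k) = ?F n $$ (j, k)"
        using v jk by (simp only: col)
    qed
  qed
  moreover have "?F n \<in> carrier_mat r r" for n
    using first_cols_carrier[of "d n" r "x n"] first_cols_carrier[of "d n" r "y n"]
    by (intro carrier_matI) auto
  ultimately show ?thesis using L unfolding entrywise_tendsto_def by auto
qed

lemma weighted_gram_limit:
  assumes dims: "D \<in> carrier_mat r r" "C \<in> carrier_mat r r" "E \<in> carrier_mat r r"
    and W: "\<And>n. dim_col (W n) = d n"
    and vecs: "\<forall>\<^sub>F n in sequentially. \<forall>k<r. x n k \<in> carrier_vec (d n) \<and> y n k \<in> carrier_vec (d n)"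
    and D: "\<And>j k. j < r \<Longrightarrow> k < r \<Longrightarrow> (\<lambda>n. (W n *\<^sub>v x n j) \<bullet> (W n *\<^sub>v x n k)) \<longlonglongrightarrow> D $$ (j, k)"
    and C: "\<And>j k. j < r \<Longrightarrow> k < r \<Longrightarrow> (\<lambda>n. (W n *\<^sub>v x n j) \<bullet> (W n *\<^sub>v y n k)) \<longlonglongrightarrow> C $$ (j, k)"
    and E: "\<And>j k. j < r \<Longrightarrow> k < r \<Longrightarrow> (\<lambda>n. (W n *\<^sub>v y n j) \<bullet> (W n *\<^sub>v y n k)) \<longlonglongrightarrow> E $$ (j, k)"
  shows "gram_limit (\<lambda>n. W n * first_cols (d n) r (x n)) (\<lambda>n. W n * first_cols (d n) r (y n)) D C E"
proof -
  have x: "\<forall>\<^sub>F n in sequentially. \<forall>k<r. x n k \<in> carrier_vec (d n) \<and> x n k \<in> carrier_vec (d n)"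
    and y: "\<forall>\<^sub>F n in sequentially. \<forall>k<r. y n k \<in> carrier_vec (d n) \<and> y n k \<in> carrier_vec (d n)"
    using vecs by (auto elim: eventually_mono)
  have "dim_col (first_cols m r z) = r" for m z using first_cols_carrier[of m r z] by auto
  then show ?thesis
    unfolding gram_limit_def
    using dims weighted_gram_tendsto[OF dims(1) W x D] weighted_gram_tendsto[OF dims(2) W vecs C]
      weighted_gram_tendsto[OF dims(3) W y E]
    by auto
qed

text \<open>
  Signal and estimator have the same shape, a small coefficient matrix between two tall factors, so the
  weighted error is a difference of two such products and \<open>weighted_product_loss_tendsto\<close> applies.
\<close>

lemma weighted_difference_factored:
  assumes V: "dim_col V = p" and W: "dim_col W = n" and B: "B \<in> carrier_mat r r"
    and X: "X = sum_outer p n r t u v"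
    and U: "U = first_cols p r uh" and U': "U' = first_cols n r vh"
  shows "V * (U * B * U'\<^sup>T - X) * W\<^sup>T
    = (V * U) * B * (W * U')\<^sup>T
      - (V * first_cols p r u) * mat_diag r t * (W * first_cols n r v)\<^sup>T"
proof -
  note [simp del] = assoc_mult_mat
  note car = first_cols_carrier[of p r u] first_cols_carrier[of n r v]
    first_cols_carrier[of p r uh] first_cols_carrier[of n r vh]
  have W': "W\<^sup>T \<in> carrier_mat n (dim_row W)" and V': "V \<in> carrier_mat (dim_row V) p"
    using V W by auto
  have S: "first_cols p r x * A * (first_cols n r y)\<^sup>T \<in> carrier_mat p n"
    if "A \<in> carrier_mat r r" for x y A
    by (rule sandwich_carrier_mat[OF first_cols_carrier that first_cols_carrier])
  have outer: "V * (first_cols p r x * A * (first_cols n r y)\<^sup>T) * W\<^sup>T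
      = (V * first_cols p r x) * A * (W * first_cols n r y)\<^sup>T" if "A \<in> carrier_mat r r" for x y A
    using that V W first_cols_carrier[of p r x] first_cols_carrier[of n r y]
    by (simp add: transpose_mult_dim mult_mat_assoc_dim)
  show ?thesis
    unfolding X U U' sum_outer_factored mult_minus_distrib_mat[OF V' S[OF B] S[OF mat_diag_dim]]
      minus_mult_distrib_mat[OF mult_carrier_mat[OF V' S[OF B]]
        mult_carrier_mat[OF V' S[OF mat_diag_dim]] W']
    by (simp only: outer[OF B] outer[OF mat_diag_dim])
qed

lemma AE_all_less:
  assumes "\<And>j k. j < (r::nat) \<Longrightarrow> k < (s::nat) \<Longrightarrow> AE \<omega> in M. P j k \<omega>"
  shows "AE \<omega> in M. \<forall>j<r. \<forall>k<s. P j k \<omega>"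
proof -
  have "AE \<omega> in M. \<forall>j k. j < r \<longrightarrow> k < s \<longrightarrow> P j k \<omega>"
    unfolding AE_all_countable by (intro allI AE_impI assms)
  then show ?thesis by eventually_elim auto
qed

text \<open>
  On a probability space an almost sure statement holds somewhere, so almost sure limits are unique and
  the description \<open>THE\<close> denotes the limit.
\<close>

lemma asymptotic_loss_eq:
  assumes M: "prob_space M" and l: "has_asymptotic_loss M V W A X l"
  shows "asymptotic_loss M V W A X = l"
  unfolding asymptotic_loss_def
proof (rule the_equality)
  show "has_asymptotic_loss M V W A X l" by (rule l)
next
  fix l' assume "has_asymptotic_loss M V W A X l'"
  with l have "AE \<omega> in M. l' = l"
    unfolding has_asymptotic_loss_def by eventually_elim (rule LIMSEQ_unique)
  then show "l' = l"
    by (simp add: prob_space.AE_const[OF M])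
qed

section \<open>Optimality of the pseudoinverse coefficients\<close>

theorem theorem4p1:
  fixes M :: "'a measure" and p :: "nat \<Rightarrow> nat" and \<gamma> :: real
    and r :: nat and t :: "nat \<Rightarrow> real"
    and u v uh vh :: "nat \<Rightarrow> 'a \<Rightarrow> nat \<Rightarrow> real vec"
    and sv :: "nat \<Rightarrow> 'a \<Rightarrow> nat \<Rightarrow> real"
    and G X Y Uh Vh :: "nat \<Rightarrow> 'a \<Rightarrow> real mat"
    and \<Omega> \<Psi> :: "nat \<Rightarrow> real mat"
    and \<mu> \<nu> :: real
    and C C' D D' E E' Bh :: "real mat"
  assumes model: "spiked_model M p \<gamma> r t u v G"
    and X: "\<And>n \<omega>. X n \<omega> = sum_outer (p n) n r t (u n \<omega>) (v n \<omega>)"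
    and Y: "\<And>n \<omega>. Y n \<omega> = X n \<omega> + G n \<omega>"
    and svd: "\<And>n \<omega>. \<omega> \<in> space M \<Longrightarrow> is_svd (Y n \<omega>) (sv n \<omega>) (uh n \<omega>) (vh n \<omega>)"
    and Uh: "\<And>n \<omega>. Uh n \<omega> = first_cols (p n) r (uh n \<omega>)"
    and Vh: "\<And>n \<omega>. Vh n \<omega> = first_cols n r (vh n \<omega>)"
    and cols: "\<And>q. dim_col (\<Omega> q) = q" "\<And>n. dim_col (\<Psi> n) = n"
    and bounded: "\<exists>K. (\<forall>q. mat_op_norm (\<Omega> q) \<le> K) \<and> (\<forall>n. mat_op_norm (\<Psi> n) \<le> K)"
    and \<mu>: "(\<lambda>n. mat_trace ((\<Omega> (p n))\<^sup>T * \<Omega> (p n)) / real (p n)) \<longlonglongrightarrow> \<mu>" "0 < \<mu>"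
    and \<nu>: "(\<lambda>n. mat_trace ((\<Psi> n)\<^sup>T * \<Psi> n) / real n) \<longlonglongrightarrow> \<nu>" "0 < \<nu>"
    and dims: "C \<in> carrier_mat r r" "C' \<in> carrier_mat r r" "D \<in> carrier_mat r r"
              "D' \<in> carrier_mat r r" "E \<in> carrier_mat r r" "E' \<in> carrier_mat r r"
    and E: "\<And>j k. \<lbrakk>j < r; k < r\<rbrakk> \<Longrightarrow>
        AE \<omega> in M. (\<lambda>n. (\<Omega> (p n) *\<^sub>v u n \<omega> j) \<bullet> (\<Omega> (p n) *\<^sub>v u n \<omega> k)) \<longlonglongrightarrow> E $$ (j, k)"
    and E': "\<And>j k. \<lbrakk>j < r; k < r\<rbrakk> \<Longrightarrow>
        AE \<omega> in M. (\<lambda>n. (\<Psi> n *\<^sub>v v n \<omega> j) \<bullet> (\<Psi> n *\<^sub>v v n \<omega> k)) \<longlonglongrightarrow> E' $$ (j, k)"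
    and E_pos: "\<And>k. k < r \<Longrightarrow> 0 < E $$ (k, k)" "\<And>k. k < r \<Longrightarrow> 0 < E' $$ (k, k)"
    and sign_u: "\<And>k. k < r \<Longrightarrow> \<exists>a\<ge>0. AE \<omega> in M. (\<lambda>n. uh n \<omega> k \<bullet> u n \<omega> k) \<longlonglongrightarrow> a"
    and sign_v: "\<And>k. k < r \<Longrightarrow> \<exists>a\<ge>0. AE \<omega> in M. (\<lambda>n. vh n \<omega> k \<bullet> v n \<omega> k) \<longlonglongrightarrow> a"
    and C: "\<And>j k. \<lbrakk>j < r; k < r\<rbrakk> \<Longrightarrow>
        AE \<omega> in M. (\<lambda>n. (\<Omega> (p n) *\<^sub>v uh n \<omega> j) \<bullet> (\<Omega> (p n) *\<^sub>v u n \<omega> k)) \<longlonglongrightarrow> C $$ (j, k)"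
    and C': "\<And>j k. \<lbrakk>j < r; k < r\<rbrakk> \<Longrightarrow>
        AE \<omega> in M. (\<lambda>n. (\<Psi> n *\<^sub>v vh n \<omega> j) \<bullet> (\<Psi> n *\<^sub>v v n \<omega> k)) \<longlonglongrightarrow> C' $$ (j, k)"
    and D: "\<And>j k. \<lbrakk>j < r; k < r\<rbrakk> \<Longrightarrow>
        AE \<omega> in M. (\<lambda>n. (\<Omega> (p n) *\<^sub>v uh n \<omega> j) \<bullet> (\<Omega> (p n) *\<^sub>v uh n \<omega> k)) \<longlonglongrightarrow> D $$ (j, k)"
    and D': "\<And>j k. \<lbrakk>j < r; k < r\<rbrakk> \<Longrightarrow>
        AE \<omega> in M. (\<lambda>n. (\<Psi> n *\<^sub>v vh n \<omega> j) \<bullet> (\<Psi> n *\<^sub>v vh n \<omega> k)) \<longlonglongrightarrow> D' $$ (j, k)"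
    and Bh: "Bh = pinv D * C * mat_diag r t * C'\<^sup>T * pinv D'"
  shows "(\<forall>B\<in>carrier_mat r r. \<exists>l.
           has_asymptotic_loss M (\<lambda>n. \<Omega> (p n)) \<Psi> (\<lambda>n \<omega>. Uh n \<omega> * B * (Vh n \<omega>)\<^sup>T) X l) \<and>
         is_arg_min
           (\<lambda>B. asymptotic_loss M (\<lambda>n. \<Omega> (p n)) \<Psi> (\<lambda>n \<omega>. Uh n \<omega> * B * (Vh n \<omega>)\<^sup>T) X)
           (\<lambda>B. B \<in> carrier_mat r r) Bh \<and>
         (AE \<omega> in M.
           (\<lambda>n. (frob_norm (\<Omega> (p n) * (Uh n \<omega> * Bh * (Vh n \<omega>)\<^sup>T - X n \<omega>) * (\<Psi> n)\<^sup>T))\<^sup>2)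
           \<longlonglongrightarrow> frob_inner (E * mat_diag r t * E'
                 - C\<^sup>T * pinv D * C * mat_diag r t * C'\<^sup>T * pinv D' * C') (mat_diag r t))"
proof -
  have M: "prob_space M" and p: "filterlim p at_top sequentially"
    and signal: "\<And>n \<omega>. r \<le> p n \<Longrightarrow> r \<le> n \<Longrightarrow> \<omega> \<in> space M \<Longrightarrow>
        orthonormal_family (p n) r (u n \<omega>) \<and> orthonormal_family n r (v n \<omega>)"
    and noise: "\<And>n \<omega>. \<omega> \<in> space M \<Longrightarrow> G n \<omega> \<in> carrier_mat (p n) n"
    using model unfolding spiked_model_def by blast+
  \<comment> \<open>For small \<open>n\<close> fewer than \<open>r\<close> singular vectors exist and their dimensions are unspecified.\<close>
  have large: "\<forall>\<^sub>F n in sequentially. r \<le> p n \<and> r \<le> n"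
    using p eventually_ge_at_top[of r] by (auto simp: filterlim_at_top eventually_conj_iff)
  have vecs: "\<forall>\<^sub>F n in sequentially. \<forall>k<r. uh n \<omega> k \<in> carrier_vec (p n) \<and> u n \<omega> k \<in> carrier_vec (p n)"
      "\<forall>\<^sub>F n in sequentially. \<forall>k<r. vh n \<omega> k \<in> carrier_vec n \<and> v n \<omega> k \<in> carrier_vec n"
    if \<omega>: "\<omega> \<in> space M" for \<omega>
  proof -
    have "(\<forall>k<r. uh n \<omega> k \<in> carrier_vec (p n) \<and> u n \<omega> k \<in> carrier_vec (p n)) \<and>
        (\<forall>k<r. vh n \<omega> k \<in> carrier_vec n \<and> v n \<omega> k \<in> carrier_vec n)"
      if n: "r \<le> p n \<and> r \<le> n" for n
    proof -
      have "dim_row (Y n \<omega>) = p n" "dim_col (Y n \<omega>) = n"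
        using noise[OF \<omega>, of n] by (auto simp: Y)
      then have "orthonormal_family (p n) (min (p n) n) (uh n \<omega>)"
          "orthonormal_family n (min (p n) n) (vh n \<omega>)"
        using svd[OF \<omega>, of n] by (auto simp: is_svd_def Let_def)
      moreover have "\<forall>k<r. k < min (p n) n" using n by auto
      ultimately show ?thesis
        using signal[of n, OF _ _ \<omega>] n by (auto simp: orthonormal_family_def)
    qed
    with large show "\<forall>\<^sub>F n in sequentially. \<forall>k<r. uh n \<omega> k \<in> carrier_vec (p n) \<and> u n \<omega> k \<in> carrier_vec (p n)"
      "\<forall>\<^sub>F n in sequentially. \<forall>k<r. vh n \<omega> k \<in> carrier_vec n \<and> v n \<omega> k \<in> carrier_vec n"
      by (auto elim!: eventually_mono)
  qed
  define a where "a \<omega> n = \<Omega> (p n) * Uh n \<omega>" for \<omega> n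
  define b where "b \<omega> n = \<Omega> (p n) * first_cols (p n) r (u n \<omega>)" for \<omega> n
  define a' where "a' \<omega> n = \<Psi> n * Vh n \<omega>" for \<omega> n
  define b' where "b' \<omega> n = \<Psi> n * first_cols n r (v n \<omega>)" for \<omega> n
  have lim: "AE \<omega> in M. gram_limit (a \<omega>) (b \<omega>) D C E"
  proof -
    have D_all: "AE \<omega> in M. \<forall>j<r. \<forall>k<r.
        (\<lambda>n. (\<Omega> (p n) *\<^sub>v uh n \<omega> j) \<bullet> (\<Omega> (p n) *\<^sub>v uh n \<omega> k)) \<longlonglongrightarrow> D $$ (j, k)"
      by (rule AE_all_less) (rule D)
    have C_all: "AE \<omega> in M. \<forall>j<r. \<forall>k<r.
        (\<lambda>n. (\<Omega> (p n) *\<^sub>v uh n \<omega> j) \<bullet> (\<Omega> (p n) *\<^sub>v u n \<omega> k)) \<longlonglongrightarrow> C $$ (j, k)"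
      by (rule AE_all_less) (rule C)
    have E_all: "AE \<omega> in M. \<forall>j<r. \<forall>k<r.
        (\<lambda>n. (\<Omega> (p n) *\<^sub>v u n \<omega> j) \<bullet> (\<Omega> (p n) *\<^sub>v u n \<omega> k)) \<longlonglongrightarrow> E $$ (j, k)"
      by (rule AE_all_less) (rule E)
    show ?thesis
      using AE_space D_all C_all E_all
    proof eventually_elim
      case (elim \<omega>)
      show ?case
        unfolding a_def b_def Uh
        by (rule weighted_gram_limit[OF dims(3,1,5) cols(1) vecs(1)[OF elim(1)]]) (use elim in auto)
    qed
  qed
  have lim': "AE \<omega> in M. gram_limit (a' \<omega>) (b' \<omega>) D' C' E'"
  proof -
    have D'_all: "AE \<omega> in M. \<forall>j<r. \<forall>k<r.
        (\<lambda>n. (\<Psi> n *\<^sub>v vh n \<omega> j) \<bullet> (\<Psi> n *\<^sub>v vh n \<omega> k)) \<longlonglongrightarrow> D' $$ (j, k)"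
      by (rule AE_all_less) (rule D')
    have C'_all: "AE \<omega> in M. \<forall>j<r. \<forall>k<r.
        (\<lambda>n. (\<Psi> n *\<^sub>v vh n \<omega> j) \<bullet> (\<Psi> n *\<^sub>v v n \<omega> k)) \<longlonglongrightarrow> C' $$ (j, k)"
      by (rule AE_all_less) (rule C')
    have E'_all: "AE \<omega> in M. \<forall>j<r. \<forall>k<r.
        (\<lambda>n. (\<Psi> n *\<^sub>v v n \<omega> j) \<bullet> (\<Psi> n *\<^sub>v v n \<omega> k)) \<longlonglongrightarrow> E' $$ (j, k)"
      by (rule AE_all_less) (rule E')
    show ?thesis
      using AE_space D'_all C'_all E'_all
    proof eventually_elim
      case (elim \<omega>)
      show ?case
        unfolding a'_def b'_def Vh
        by (rule weighted_gram_limit[OF dims(4,2,6) cols(2) vecs(2)[OF elim(1)]]) (use elim in auto)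
    qed
  qed
  let ?T = "mat_diag r t"
  define loss where "loss B = frob_inner B (D * B * D') - 2 * frob_inner B (C * ?T * C'\<^sup>T)
      + frob_inner ?T (E * ?T * E')" for B
  have dims_C: "dim_row C = r" "dim_col C = r" "dim_row C' = r" "dim_col C' = r"
    using dims by auto
  note T = mat_diag_dim[of r t]
  have has_loss: "has_asymptotic_loss M (\<lambda>n. \<Omega> (p n)) \<Psi> (\<lambda>n \<omega>. Uh n \<omega> * B * (Vh n \<omega>)\<^sup>T) X (loss B)"
    if B: "B \<in> carrier_mat r r" for B
    unfolding has_asymptotic_loss_def weighted_loss_def
    using lim lim'
  proof eventually_elim
    case (elim \<omega>)
    have "\<Omega> (p n) * (Uh n \<omega> * B * (Vh n \<omega>)\<^sup>T - X n \<omega>) * (\<Psi> n)\<^sup>T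
        = a \<omega> n * B * (a' \<omega> n)\<^sup>T - b \<omega> n * ?T * (b' \<omega> n)\<^sup>T" for n
      unfolding a_def b_def a'_def b'_def
      by (rule weighted_difference_factored[OF cols B X Uh Vh])
    then show ?case
      using weighted_product_loss_tendsto[OF elim, of B ?T] B T by (simp only: loss_def dims_C)
  qed
  have loss: "asymptotic_loss M (\<lambda>n. \<Omega> (p n)) \<Psi> (\<lambda>n \<omega>. Uh n \<omega> * B * (Vh n \<omega>)\<^sup>T) X = loss B"
    if "B \<in> carrier_mat r r" for B
    by (rule asymptotic_loss_eq[OF M has_loss[OF that]])
  \<comment> \<open>The limit matrices are deterministic, so one good realisation proves the algebraic relations between them.\<close>
  have "AE \<omega> in M. gram_limit (a \<omega>) (b \<omega>) D C E \<and> gram_limit (a' \<omega>) (b' \<omega>) D' C' E'"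
    using lim lim' by eventually_elim simp
  then obtain \<omega>\<^sub>0 where g: "gram_limit (a \<omega>\<^sub>0) (b \<omega>\<^sub>0) D C E" and g': "gram_limit (a' \<omega>\<^sub>0) (b' \<omega>\<^sub>0) D' C' E'"
    using eventually_happens'[OF prob_space.ae_filter_bot[OF M]] by blast
  have T': "?T \<in> carrier_mat (dim_col C) (dim_col C')" by (simp add: dims_C)
  have Bh_car: "Bh \<in> carrier_mat r r"
    unfolding Bh using dims gram_limit_pinv(1)[OF g] gram_limit_pinv(1)[OF g']
    by (intro mult_carrier_mat) (auto simp: dims_C)
  have minimal: "loss Bh \<le> loss B" if B: "B \<in> carrier_mat r r" for B
  proof -
    have crit: "D * Bh * D' = C * ?T * C'\<^sup>T"
      unfolding Bh by (rule pinv_coefficients_critical[OF g g' T'])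
    have "frob_inner Bh (D * Bh * D') - 2 * frob_inner Bh (C * ?T * C'\<^sup>T)
        \<le> frob_inner B (D * B * D') - 2 * frob_inner B (C * ?T * C'\<^sup>T)"
      using gram_limit_sandwich_nonneg[OF g g'] dims_C
      by (intro quadratic_loss_minimum[OF dims(3) gram_limit_symmetric(1)[OF g] dims(4)
            gram_limit_symmetric(1)[OF g'] _ B Bh_car crit]) auto
    then show ?thesis by (simp add: loss_def)
  qed
  have value_Bh: "loss Bh = frob_inner (E * ?T * E'
      - C\<^sup>T * pinv D * C * ?T * C'\<^sup>T * pinv D' * C') ?T"
    unfolding loss_def by (rule pinv_coefficients_value[OF g g' T' Bh])
  show ?thesis
  proof (intro conjI)
    show "is_arg_min
        (\<lambda>B. asymptotic_loss M (\<lambda>n. \<Omega> (p n)) \<Psi> (\<lambda>n \<omega>. Uh n \<omega> * B * (Vh n \<omega>)\<^sup>T) X)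
        (\<lambda>B. B \<in> carrier_mat r r) Bh"
      using minimal Bh_car by (auto simp: is_arg_min_linorder loss)
    show "AE \<omega> in M.
        (\<lambda>n. (frob_norm (\<Omega> (p n) * (Uh n \<omega> * Bh * (Vh n \<omega>)\<^sup>T - X n \<omega>) * (\<Psi> n)\<^sup>T))\<^sup>2)
        \<longlonglongrightarrow> frob_inner (E * ?T * E' - C\<^sup>T * pinv D * C * ?T * C'\<^sup>T * pinv D' * C') ?T"
      using has_loss[OF Bh_car]
      unfolding has_asymptotic_loss_def weighted_loss_def value_Bh .
  qed (use has_loss in blast)
qed

end
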